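(* Let $h:\mathbb{R}\to[H_1,H_2]\subset(0,1)$ be continuous, $p\in\mathbb{N}$ and $F\in\mathcal{S}_{-p}(\mathbb{R})$. There is a constant $C_p^{(H_1,H_2)}$, independent of $F$ and $t$, such that for all $t>0$, $$\|F(B^{(h)}(t))\|^2_{-p}\le\max\{t^{-4ph(t)},t^{4ph(t)}\}\,t^{-h(t)}\,C_p^{(H_1,H_2)}\,|F|_{-p}^2.$$
   Context: White noise setting: $\Omega=\mathcal{S}'(\mathbb{R})$ with white noise measure $\mu$; $\langle\cdot,f\rangle$ for $f\in L^2(\mathbb{R})$. Hermite functions $e_k$ and Hermite polynomials $h_k$; $A=-\frac{d^2}{dx^2}+x^2+1$, $|f|_p^2=\sum_k(2k+2)^{2p}\langle f,e_k\rangle^2$, $\mathcal{S}_{-p}(\mathbb{R})$ the completion of $L^2$ under $|\cdot|_{-p}$; $\|\Phi\|_{-p}=\|\Gamma(A)^{-p}\Phi\|_{(L^2)}$ with $\Gamma(A)$ the second quantization, so $\|\sum_kI_k(f_k)\|_{-p}^2=\sum_kk!\,|(A^{-p})^{\otimes k}f_k|_0^2$. $c_x=(2\pi/(\Gamma(2x+1)\sin\pi x))^{1/2}$; $M_H$ defined by $\widehat{M_H(u)}(y)=\frac{\sqrt{2\pi}}{c_H}|y|^{1/2-H}\widehat u(y)$ ($\widehat f(\xi)=\int e^{-ix\xi}f$); $\mathbf{1}_{[0,t]}$ the indicator of $[0,t]$. $B^{(h)}(t)=\langle\cdot,M_{h(t)}(\mathbf{1}_{[0,t]})\rangle$. For $F\in\mathcal{S}'(\mathbb{R})$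 and $t>0$, $F(B^{(h)}(t)):=\frac{1}{\sqrt{2\pi}t^{h(t)}}\sum_{k\ge0}(k!)^{-1}t^{-2kh(t)}\langle F,\xi_{t,h(t),k}\rangle I_k\big((M_{h(t)}(\mathbf{1}_{[0,t]}))^{\otimes k}\big)$, with $I_k$ the $k$-th multiple Wiener–Itô integral and $\xi_{t,H,k}(x)=2^{-k/2}t^{kH}h_k(x/(\sqrt2t^H))e^{-x^2/(2t^{2H})}$. *)

theory Defs
  imports "HOL-Analysis.Analysis"
begin

fun hermite_poly :: "nat \<Rightarrow> real \<Rightarrow> real" where
  "hermite_poly 0 x = 1"
| "hermite_poly (Suc 0) x = 2 * x"
| "hermite_poly (Suc (Suc k)) x = 2 * x * hermite_poly (Suc k) x - 2 * real (Suc k) * hermite_poly k x"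

(* Hermite functions e_k (orthonormal basis of L^2(R)) *)
definition hermite_fun :: "nat \<Rightarrow> real \<Rightarrow> real" where
  "hermite_fun k x = hermite_poly k x * exp (- (x^2) / 2) / sqrt (sqrt pi * 2 ^ k * fact k)"

definition xi_fun :: "real \<Rightarrow> real \<Rightarrow> nat \<Rightarrow> real \<Rightarrow> real" where
  "xi_fun t H k x = 2 powr (- real k / 2) * t powr (real k * H)
      * hermite_poly k (x / (sqrt 2 * t powr H)) * exp (- (x^2) / (2 * t powr (2 * H)))"

definition c_const :: "real \<Rightarrow> real" where
  "c_const x = sqrt (2 * pi / (Gamma (2 * x + 1) * sin (pi * x)))"

definition fourier :: "(real \<Rightarrow> real) \<Rightarrow> real \<Rightarrow> complex" where
  "fourier f y = integral\<^sup>L lborel (\<lambda>x. cis (- (x * y)) * complex_of_real (f x))"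

(* Fourier transform of M_H(1_[0,t]):  (sqrt(2pi)/c_H) |y|^{1/2-H} \<hat>1_[0,t](y) *)
definition MH_ind_hat :: "real \<Rightarrow> real \<Rightarrow> real \<Rightarrow> complex" where
  "MH_ind_hat H t y = complex_of_real (sqrt (2 * pi) / c_const H * \<bar>y\<bar> powr (1/2 - H))
      * fourier (indicator {0..t}) y"

(* Hermite coefficient <M_H(1_[0,t]), e_j>, computed via Plancherel:
   <g, e_j> = (1/2pi) \<integral> \<hat>g(y) conj(\<hat>e_j(y)) dy  (a real number) *)
definition MH_coeff :: "real \<Rightarrow> real \<Rightarrow> nat \<Rightarrow> real" where
  "MH_coeff H t j = Re (integral\<^sup>L lborel
      (\<lambda>y. MH_ind_hat H t y * cnj (fourier (hermite_fun j) y)) / complex_of_real (2 * pi))"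

definition MH_ind_norm_sq :: "nat \<Rightarrow> real \<Rightarrow> real \<Rightarrow> real" where
  "MH_ind_norm_sq p H t = (\<Sum>j. (MH_coeff H t j)^2 / (2 * real j + 2) ^ (2 * p))"

(* An element F of S_{-p}(R) is represented by its Hermite coefficients a_j = <F, e_j>;
   F \<in> S_{-p} iff \<Sum> (2j+2)^{-2p} a_j^2 < \<infinity>. *)
definition in_S_neg :: "nat \<Rightarrow> (nat \<Rightarrow> real) \<Rightarrow> bool" where
  "in_S_neg p a \<longleftrightarrow> summable (\<lambda>j. (a j)^2 / (2 * real j + 2) ^ (2 * p))"

definition S_neg_norm_sq :: "nat \<Rightarrow> (nat \<Rightarrow> real) \<Rightarrow> real" where
  "S_neg_norm_sq p a = (\<Sum>j. (a j)^2 / (2 * real j + 2) ^ (2 * p))"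

definition pairing :: "(nat \<Rightarrow> real) \<Rightarrow> (real \<Rightarrow> real) \<Rightarrow> real" where
  "pairing a \<phi> = (\<Sum>j. a j * integral\<^sup>L lborel (\<lambda>x. hermite_fun j x * \<phi> x))"

(* F(B^{(h)}(t)) = \<Sum>_k I_k(f_k) with f_k = c_k (M_H 1_[0,t])^{\<otimes>k}, H = h(t), where c_k is: *)
definition FB_coeff :: "(nat \<Rightarrow> real) \<Rightarrow> real \<Rightarrow> real \<Rightarrow> nat \<Rightarrow> real" where
  "FB_coeff a H t k = 1 / (sqrt (2 * pi) * t powr H) * (1 / fact k) * t powr (- 2 * real k * H)
      * pairing a (xi_fun t H k)"

(* k-th term of ||F(B^{(h)}(t))||_{-p}^2 = \<Sum>_k k! |(A^{-p})^{\<otimes>k} f_k|_0^2, using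
   |(A^{-p})^{\<otimes>k} (c g^{\<otimes>k})|_0^2 = c^2 |A^{-p} g|_0^{2k} = c^2 (|g|_{-p}^2)^k *)
definition FB_term :: "nat \<Rightarrow> (nat \<Rightarrow> real) \<Rightarrow> real \<Rightarrow> real \<Rightarrow> nat \<Rightarrow> real" where
  "FB_term p a H t k = fact k * (FB_coeff a H t k)^2 * (MH_ind_norm_sq p H t) ^ k"

end

(* The square of the norm is a series in k whose k-th term is the product of a power of the
   (-p)-norm of M_H(1_[0,t]) and the square of the pairing of F with xi_{t,H,k}.  Since
   A >= 2 and the constant c_H makes |M_H(1_[0,t])|_0 = t^H, the first norm is at most 2^{-p} t^H.  Up to normalisation, xi_{t,H,k} is
   b_k(x) = e_k(x/s) exp(-x^2/(2s^2)) with s = sqrt 2 t^H.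

   If p = 0, the Gaussian factor is moved to F, and Bessel's inequality for the orthonormal family
   e_k(x/s)/sqrt s bounds the sum over k.  If p > 0, the factors 4^{-pk} leave room for polynomial
   growth in k, so a Cauchy-Schwarz estimate of each term suffices: A is symmetric and maps b_k to a
   combination of b_{k+2}, b_k and b_{k-2} with coefficients of order max(s^2, s^{-2}) k, hence
   |b_k|_p is at most a constant times max(s^2, s^{-2})^p k^p sqrt s. *)
theory Submission
  imports Defs
    "HOL-Probability.Characteristic_Functions"
    "HOL-Computational_Algebra.Polynomial"
    "HOL-Real_Asymp.Real_Asymp"
begin

section \<open>Integration by parts for polynomials times Gaussians\<close>

text \<open>With y = x/s the Gaussian of \<open>xi_fun\<close> is the full Hermite weight exp(-y^2),
  twice the exponent carried by e_k(y). This has two effects. The surplus half is a multiplier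
  bounded by 1, which is what makes the p = 0 case work. And h_k(y) exp(-y^2) is, up to sign, the
  k-th derivative of exp(-y^2), so d^2/dx^2 sends the k-th test function to a multiple of the
  (k+2)-nd alone, with factor 1/s^2, while x^2 = s^2 y^2 produces the orders k+2, k and k-2. This is
  the origin of s^2 and s^{-2}.

  Exponents of t: s^2 is 2 t^(2h), so max(s^2, s^{-2})^(2p) gives the maximum of t^(-4ph) and
  t^(4ph); the squared prefactor t^(-2h) times the factor s gives t^(-h).

  Uniformity in the Hurst parameter comes from evaluating the L^2 norm of the transformed indicator
  exactly: the Gamma and sine factors cancel.

  Only upper bounds are wanted, so Bessel's inequality on finite index sets is the main tool;
  infinite series are reached by passing to the limit.\<close>

lemma integrable_power_gaussian:
  fixes c :: real assumes "0 < c"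
  shows "integrable lborel (\<lambda>x. x ^ n * exp (- c * x\<^sup>2))"
proof -
  \<comment> \<open>The standard deviation for which the centred normal density is proportional to
    exp(-c x^2).\<close>
  define s where "s = 1 / sqrt (2 * c)"
  have s: "s > 0" "s\<^sup>2 = 1 / (2 * c)"
    using assms by (auto simp: s_def power_divide)
  have "integrable lborel (\<lambda>x. sqrt (2 * pi * s\<^sup>2) * (normal_density 0 s x * (x - 0) ^ n))"
    by (intro integrable_mult_right integrable_normal_moment s)
  also have "(\<lambda>x. sqrt (2 * pi * s\<^sup>2) * (normal_density 0 s x * (x - 0) ^ n))
    = (\<lambda>x. x ^ n * exp (- c * x\<^sup>2))"
    using assms by (auto simp: normal_density_def s fun_eq_iff field_simps)
  finally show ?thesis .
qed

lemma integrable_poly_gaussian: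
  fixes c :: real assumes "0 < c"
  shows "integrable lborel (\<lambda>x. poly P x * exp (- c * x\<^sup>2))"
proof -
  have "integrable lborel (\<lambda>x. \<Sum>i\<le>degree P. coeff P i * (x ^ i * exp (- c * x\<^sup>2)))"
    by (intro Bochner_Integration.integrable_sum integrable_mult_right integrable_power_gaussian assms)
  then show ?thesis
    by (simp add: poly_altdef sum_distrib_right mult.assoc)
qed

lemma tendsto_poly_gaussian:
  fixes c :: real assumes "0 < c"
  shows "((\<lambda>x. poly P x * exp (- c * x\<^sup>2)) \<longlongrightarrow> 0) at_top"
    and "((\<lambda>x. poly P x * exp (- c * x\<^sup>2)) \<longlongrightarrow> 0) at_bot"
proof -
  have *: "((\<lambda>x. poly Q x * exp (- c * x\<^sup>2)) \<longlongrightarrow> 0) at_top" for Q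
  proof -
    have "((\<lambda>x. x ^ i * exp (- c * x\<^sup>2)) \<longlongrightarrow> 0) at_top" for i :: nat
      using assms by real_asymp
    then have "((\<lambda>x. \<Sum>i\<le>degree Q. coeff Q i * (x ^ i * exp (- c * x\<^sup>2))) \<longlongrightarrow> (\<Sum>i\<le>degree Q. coeff Q i * 0)) at_top"
      by (intro tendsto_sum tendsto_mult_left)
    then show ?thesis
      by (simp add: poly_altdef sum_distrib_right mult.assoc)
  qed
  from * show "((\<lambda>x. poly P x * exp (- c * x\<^sup>2)) \<longlongrightarrow> 0) at_top" .
  from *[of "pcompose P [:0, -1:]"] show "((\<lambda>x. poly P x * exp (- c * x\<^sup>2)) \<longlongrightarrow> 0) at_bot"
    by (simp add: filterlim_at_bot_mirror poly_pcompose)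
qed

lemma integrable_cis_poly_gaussian:
  fixes c y :: real assumes "0 < c"
  shows "integrable lborel (\<lambda>x. cis (- (x * y)) * complex_of_real (poly P x * exp (- c * x\<^sup>2)))"
proof (rule Bochner_Integration.integrable_bound[OF integrable_poly_gaussian[OF assms, of P]])
  show "(\<lambda>x. cis (- (x * y)) * complex_of_real (poly P x * exp (- c * x\<^sup>2))) \<in> borel_measurable lborel"
    unfolding cis_conv_exp
    by (simp, intro borel_measurable_continuous_onI continuous_intros)
qed (simp add: norm_mult)

lemma has_vector_derivative_cis_neg_mult:
  fixes y :: real
  shows "((\<lambda>x. cis (- (x * y))) has_vector_derivative (- \<i> * y * cis (- (x * y)))) (at x within S)"
  unfolding has_vector_derivative_complex_iff by (auto intro!: derivative_eq_intros)

text \<open>\<open>pderiv P - smult (2 * c) ([:0, 1:] * P)\<close> is the polynomial factor of the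
  derivative of P(x) exp(-c x^2). The identity is therefore the rule that the Fourier transform
  turns d/dx into multiplication by i y; the boundary terms vanish by Gaussian decay. At y = 0 it
  says that such total derivatives integrate to zero, which serves for orthogonality and for the
  recurrence of the moments.\<close>

lemma integral_cis_deriv_poly_gaussian:
  fixes c y :: real assumes c: "0 < c"
  shows "integral\<^sup>L lborel (\<lambda>x. cis (- (x * y)) * complex_of_real (poly (pderiv P - smult (2 * c) ([:0, 1:] * P)) x * exp (- c * x\<^sup>2)))
    = \<i> * y * integral\<^sup>L lborel (\<lambda>x. cis (- (x * y)) * complex_of_real (poly P x * exp (- c * x\<^sup>2)))"
proof -
  define G where "G Q x = cis (- (x * y)) * complex_of_real (poly Q x * exp (- c * x\<^sup>2))" for Q x
  define Q where "Q = pderiv P - smult (2 * c) ([:0, 1:] * P)"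
  have int: "integrable lborel (G R)" for R
    unfolding G_def by (rule integrable_cis_poly_gaussian[OF c])
  have cont: "isCont (G R) x" for R x
    unfolding G_def cis_conv_exp by (intro continuous_intros)
  have lim: "(G P \<longlongrightarrow> 0) F" if "((\<lambda>x. poly P x * exp (- c * x\<^sup>2)) \<longlongrightarrow> 0) F" for F
    by (rule tendsto_norm_zero_cancel) (use tendsto_norm_zero[OF that] in \<open>simp add: G_def norm_mult abs_mult\<close>)
  have der: "(G P has_vector_derivative (G Q x - \<i> * y * G P x)) (at x)" for x
  proof -
    have "((\<lambda>x. complex_of_real (poly P x * exp (- c * x\<^sup>2))) has_vector_derivative
        complex_of_real (poly Q x * exp (- c * x\<^sup>2))) (at x)"
      by (rule has_vector_derivative_of_real)
        (auto simp: Q_def algebra_simps intro!: derivative_eq_intros)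
    then have "(G P has_vector_derivative
        (cis (- (x * y)) * complex_of_real (poly Q x * exp (- c * x\<^sup>2))
          + - \<i> * y * cis (- (x * y)) * complex_of_real (poly P x * exp (- c * x\<^sup>2)))) (at x)"
      unfolding G_def by (rule has_vector_derivative_mult[OF has_vector_derivative_cis_neg_mult])
    then show ?thesis by (simp add: G_def algebra_simps)
  qed
  have "(LBINT x=-\<infinity>..\<infinity>. (G Q x - \<i> * y * G P x)) = 0 - 0"
  proof (rule interval_integral_FTC_integrable)
    show "set_integrable lborel (einterval (-\<infinity>) \<infinity>) (\<lambda>x. G Q x - \<i> * y * G P x)"
      using int by (simp add: set_integrable_def einterval_def)
    show "((G P \<circ> real_of_ereal) \<longlongrightarrow> 0) (at_right (-\<infinity>))"
      using lim[OF tendsto_poly_gaussian(2)[OF c]] by (simp add: ereal_tendsto_simps)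
    show "((G P \<circ> real_of_ereal) \<longlongrightarrow> 0) (at_left \<infinity>)"
      using lim[OF tendsto_poly_gaussian(1)[OF c]] by (simp add: ereal_tendsto_simps)
  qed (auto intro!: der cont continuous_intros)
  then have "integral\<^sup>L lborel (\<lambda>x. G Q x - \<i> * y * G P x) = 0"
    by (simp add: interval_integral_to_infinity_eq interval_lebesgue_integral_def set_lebesgue_integral_def)
  then have "integral\<^sup>L lborel (G Q) = \<i> * y * integral\<^sup>L lborel (G P)"
    using int by simp
  then show ?thesis
    by (simp only: G_def[abs_def] Q_def)
qed

corollary integral_deriv_poly_gaussian:
  fixes c :: real assumes c: "0 < c"
  shows "integral\<^sup>L lborel (\<lambda>x. poly (pderiv P - smult (2 * c) ([:0, 1:] * P)) x * exp (- c * x\<^sup>2)) = 0"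
proof -
  have "integral\<^sup>L lborel (\<lambda>x. complex_of_real (poly (pderiv P - smult (2 * c) ([:0, 1:] * P)) x * exp (- c * x\<^sup>2))) = 0"
    using integral_cis_deriv_poly_gaussian[OF c, of 0 P] by simp
  then show ?thesis
    by (simp only: integral_complex_of_real of_real_eq_0_iff)
qed

section \<open>Hermite functions\<close>

text \<open>A formal polynomial copy of \<open>hermite_poly\<close>, so that \<open>pderiv\<close>
  and the integration by parts above apply.\<close>

fun hermite :: "nat \<Rightarrow> real poly" where
  "hermite 0 = 1"
| "hermite (Suc 0) = [:0, 2:]"
| "hermite (Suc (Suc k)) = [:0, 2:] * hermite (Suc k) - smult (2 * real (Suc k)) (hermite k)"

lemma poly_hermite: "poly (hermite k) x = hermite_poly k x"
  by (induction k rule: hermite.induct) auto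

text \<open>A single recurrence for all k: at k = 0 the truncated index \<open>k - 1\<close> is
  harmless because its coefficient is 0.\<close>

lemma hermite_Suc: "hermite (Suc k) = [:0, 2:] * hermite k - smult (2 * real k) (hermite (k - 1))"
  by (cases k) auto

lemma pderiv_hermite: "pderiv (hermite k) = smult (2 * real k) (hermite (k - 1))"
proof (induction k rule: hermite.induct)
  case 2
  show ?case by (simp add: pderiv_pCons one_pCons)
next
  case (3 k)
  \<comment> \<open>Differentiating the recurrence leaves 2x h_k - 2k h_{k-1}, which this identity
    recombines into h_{k+1}.\<close>
  have "hermite (Suc k) = [:0, 2:] * hermite k - smult (2 * real k) (hermite (k - 1))"
    by (rule hermite_Suc)
  then show ?case
    using 3 by (simp add: pderiv_mult pderiv_diff pderiv_smult pderiv_pCons)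
      (simp add: poly_eq_poly_eq_iff[symmetric] fun_eq_iff algebra_simps)
qed (simp add: one_pCons pderiv_pCons)

lemma integral_exp_neg_square: "integral\<^sup>L lborel (\<lambda>x::real. exp (- x\<^sup>2)) = sqrt pi"
  using has_bochner_integral_integral_eq[OF has_bochner_integral_even_function[OF gaussian_moment_0]]
  by simp

lemma integrable_hermite_mult:
  "integrable lborel (\<lambda>x. hermite_poly j x * hermite_poly k x * exp (- x\<^sup>2))"
  using integrable_poly_gaussian[of 1 "hermite j * hermite k"] by (simp add: poly_hermite)

text \<open>Since h_{j+1} = 2x h_j - h_j', the product h_{j+1} exp(-x^2) is minus the derivative of
  h_j exp(-x^2). Moving that derivative onto h_k lowers both indices by one; iterating gives
  orthogonality.\<close>

lemma integral_hermite_Suc_mult: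
  "integral\<^sup>L lborel (\<lambda>x. hermite_poly (Suc j) x * hermite_poly k x * exp (- x\<^sup>2))
    = 2 * real k * integral\<^sup>L lborel (\<lambda>x. hermite_poly j x * hermite_poly (k - 1) x * exp (- x\<^sup>2))"
proof -
  have "0 = integral\<^sup>L lborel (\<lambda>x. poly (pderiv (hermite j * hermite k)
      - smult (2 * 1) ([:0, 1:] * (hermite j * hermite k))) x * exp (- 1 * x\<^sup>2))"
    by (rule integral_deriv_poly_gaussian[symmetric]) simp
  also have "\<dots> = integral\<^sup>L lborel (\<lambda>x. 2 * real k * (hermite_poly j x * hermite_poly (k - 1) x * exp (- x\<^sup>2))
      - hermite_poly (Suc j) x * hermite_poly k x * exp (- x\<^sup>2))"
    by (intro Bochner_Integration.integral_cong refl)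
      (simp add: pderiv_mult pderiv_hermite hermite_Suc poly_hermite[symmetric] algebra_simps)
  finally show ?thesis
    using integrable_hermite_mult by simp
qed

lemma integral_hermite_mult:
  "integral\<^sup>L lborel (\<lambda>x. hermite_poly j x * hermite_poly k x * exp (- x\<^sup>2))
    = (if j = k then sqrt pi * 2 ^ k * fact k else 0)"
proof (induction j arbitrary: k)
  case 0
  show ?case
  proof (cases k)
    case 0
    then show ?thesis using integral_exp_neg_square by simp
  next
    case (Suc n)
    then show ?thesis using integral_hermite_Suc_mult[of n 0] by (simp add: mult.commute)
  qed
next
  case (Suc j)
  then show ?case
    using integral_hermite_Suc_mult[of j k] by (cases k) auto
qed

lemma hermite_fun_mult:
  "hermite_fun j x * hermite_fun k x = hermite_poly j x * hermite_poly k x * exp (- x\<^sup>2)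
    / (sqrt (sqrt pi * 2 ^ j * fact j) * sqrt (sqrt pi * 2 ^ k * fact k))"
  by (simp add: hermite_fun_def field_simps flip: exp_add)

lemma integrable_hermite_fun_mult: "integrable lborel (\<lambda>x. hermite_fun j x * hermite_fun k x)"
  unfolding hermite_fun_mult by (intro integrable_divide integrable_hermite_mult)

lemma integrable_hermite_fun_square: "integrable lborel (\<lambda>x. (hermite_fun j x)\<^sup>2)"
  using integrable_hermite_fun_mult[of j j] by (simp add: power2_eq_square)

lemma integral_hermite_fun_mult:
  "integral\<^sup>L lborel (\<lambda>x. hermite_fun j x * hermite_fun k x) = (if j = k then 1 else 0)"
  unfolding hermite_fun_mult by (simp add: integral_hermite_mult)

section \<open>Fourier transforms of the Hermite functions, and Bessel's inequality\<close>

lemma fourier_gaussian: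
  "integral\<^sup>L lborel (\<lambda>x. cis (- (x * y)) * complex_of_real (exp (- (1/2) * x\<^sup>2)))
    = complex_of_real (sqrt (2 * pi) * exp (- y\<^sup>2 / 2))"
proof -
  have "complex_of_real (exp (- y\<^sup>2 / 2)) = integral\<^sup>L std_normal_distribution (\<lambda>x. iexp (- y * x))"
    using fun_cong[OF char_std_normal_distribution, of "- y"] by (simp add: char_def)
  also have "\<dots> = integral\<^sup>L lborel (\<lambda>x. std_normal_density x *\<^sub>R iexp (- y * x))"
    by (rule integral_density) (auto simp: normal_density_nonneg)
  also have "\<dots> = integral\<^sup>L lborel (\<lambda>x. (1 / complex_of_real (sqrt (2 * pi))) * (cis (- (x * y)) * complex_of_real (exp (- (1/2) * x\<^sup>2))))"
    by (intro Bochner_Integration.integral_cong refl)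
      (simp add: normal_density_def cis_conv_exp scaleR_conv_of_real mult_ac)
  finally show ?thesis
    by (simp only: integral_mult_right_zero) (simp add: field_simps)
qed

text \<open>Integrating by parts turns the three-term recurrence of the Hermite polynomials into the recurrence
  \<open>step\<close> below, so there is no need to differentiate under the integral sign.\<close>
lemma fourier_hermite_poly_gaussian:
  "integral\<^sup>L lborel (\<lambda>x. cis (- (x * y)) * complex_of_real (hermite_poly k x * exp (- (1/2) * x\<^sup>2)))
    = sqrt (2 * pi) * (- \<i>) ^ k * hermite_poly k y * complex_of_real (exp (- y\<^sup>2 / 2))"
proof -
  define G where "G P = integral\<^sup>L lborel (\<lambda>x. cis (- (x * y)) * complex_of_real (poly P x * exp (- (1/2) * x\<^sup>2)))" for P
  have int: "integrable lborel (\<lambda>x. cis (- (x * y)) * complex_of_real (poly P x * exp (- (1/2) * x\<^sup>2)))" for P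
    by (rule integrable_cis_poly_gaussian) simp
  have diff: "G (P - Q) = G P - G Q" for P Q
    using Bochner_Integration.integral_diff[OF int[of P] int[of Q]] by (simp add: G_def algebra_simps)
  have smult: "G (smult r P) = r * G P" for r P
    unfolding G_def by (subst integral_mult_right_zero[symmetric]) (simp add: mult_ac)
  have step: "G (hermite (Suc j)) = 2 * of_nat j * G (hermite (j - 1)) - 2 * \<i> * y * G (hermite j)" for j
  proof -
    \<comment> \<open>For the weight exp(-x^2/2) total derivatives have the polynomial factor P' - x
      P. Splitting 2x h_j - h_j' along this form leaves h_j' = 2j h_{j-1}, which has lower
      index.\<close>
    have "hermite (Suc j) = pderiv (hermite j) - smult 2 (pderiv (hermite j) - smult (2 * (1/2)) ([:0, 1:] * hermite j))"
      unfolding hermite_Suc pderiv_hermite by (simp add: poly_eq_poly_eq_iff[symmetric] fun_eq_iff algebra_simps)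
    then have "G (hermite (Suc j)) = G (pderiv (hermite j)) - 2 * G (pderiv (hermite j) - smult (2 * (1/2)) ([:0, 1:] * hermite j))"
      by (simp only: diff smult) simp
    also have "G (pderiv (hermite j) - smult (2 * (1/2)) ([:0, 1:] * hermite j)) = \<i> * y * G (hermite j)"
      unfolding G_def by (rule integral_cis_deriv_poly_gaussian) simp
    finally show ?thesis
      by (simp add: pderiv_hermite smult)
  qed
  have "G (hermite k) = sqrt (2 * pi) * (- \<i>) ^ k * poly (hermite k) y * complex_of_real (exp (- y\<^sup>2 / 2))"
  proof (induction k rule: hermite.induct)
    case 1
    show ?case using fourier_gaussian[of y] by (simp add: G_def)
  next
    case 2
    show ?case using fourier_gaussian[of y] step[of 0] by (simp add: G_def)
  next
    case (3 k)
    show ?case unfolding step[of "Suc k"] using 3 by (simp add: algebra_simps)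
  qed
  then show ?thesis
    by (simp add: G_def poly_hermite)
qed

text \<open>Because the eigenvalues all have modulus sqrt(2 pi), \<open>MH_coeff\<close> reduces to
  an ordinary Hermite coefficient of \<open>MH_ind_hat\<close>, up to a constant of known modulus
  and a real part.\<close>

lemma fourier_hermite_fun:
  "fourier (hermite_fun k) y = sqrt (2 * pi) * (- \<i>) ^ k * hermite_fun k y"
proof -
  have "fourier (hermite_fun k) y = integral\<^sup>L lborel (\<lambda>x. (1 / complex_of_real (sqrt (sqrt pi * 2 ^ k * fact k)))
      * (cis (- (x * y)) * complex_of_real (hermite_poly k x * exp (- (1/2) * x\<^sup>2))))"
    unfolding fourier_def by (intro Bochner_Integration.integral_cong refl) (simp add: hermite_fun_def)
  also have "\<dots> = (1 / complex_of_real (sqrt (sqrt pi * 2 ^ k * fact k)))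
      * (sqrt (2 * pi) * (- \<i>) ^ k * hermite_poly k y * complex_of_real (exp (- y\<^sup>2 / 2)))"
    by (simp only: integral_mult_right_zero fourier_hermite_poly_gaussian)
  finally show ?thesis
    by (simp add: hermite_fun_def)
qed

text \<open>Expand the integral of the square of f minus its projection, which is nonnegative. It is
  applied with the e_j, to the transformed indicator and to the test functions, and with the dilated
  e_k, where the index is the chaos order.\<close>

lemma bessel_inequality:
  fixes f :: "'a \<Rightarrow> real" and \<phi> :: "'b \<Rightarrow> 'a \<Rightarrow> real"
  assumes "finite J"
    and f2: "integrable M (\<lambda>x. (f x)\<^sup>2)"
    and f\<phi>: "\<And>i. i \<in> J \<Longrightarrow> integrable M (\<lambda>x. f x * \<phi> i x)"
    and \<phi>\<phi>: "\<And>i j. i \<in> J \<Longrightarrow> j \<in> J \<Longrightarrow> integrable M (\<lambda>x. \<phi> i x * \<phi> j x)"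
    and on: "\<And>i j. i \<in> J \<Longrightarrow> j \<in> J \<Longrightarrow> integral\<^sup>L M (\<lambda>x. \<phi> i x * \<phi> j x) = (if i = j then 1 else 0)"
  shows "(\<Sum>i\<in>J. (integral\<^sup>L M (\<lambda>x. f x * \<phi> i x))\<^sup>2) \<le> integral\<^sup>L M (\<lambda>x. (f x)\<^sup>2)"
proof -
  define c where "c i = integral\<^sup>L M (\<lambda>x. f x * \<phi> i x)" for i
  have eq: "(f x - (\<Sum>i\<in>J. c i * \<phi> i x))\<^sup>2
      = (f x)\<^sup>2 - (\<Sum>i\<in>J. 2 * c i * (f x * \<phi> i x)) + (\<Sum>i\<in>J. \<Sum>j\<in>J. c i * c j * (\<phi> i x * \<phi> j x))" for x
  proof -
    have "(\<Sum>i\<in>J. \<Sum>j\<in>J. c i * c j * (\<phi> i x * \<phi> j x)) = (\<Sum>i\<in>J. c i * \<phi> i x) * (\<Sum>j\<in>J. c j * \<phi> j x)"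
      by (simp add: sum_product mult_ac)
    moreover have "(\<Sum>i\<in>J. 2 * c i * (f x * \<phi> i x)) = 2 * f x * (\<Sum>i\<in>J. c i * \<phi> i x)"
      by (simp add: sum_distrib_left mult_ac)
    ultimately show ?thesis
      by (simp add: power2_eq_square algebra_simps)
  qed
  have "0 \<le> integral\<^sup>L M (\<lambda>x. (f x - (\<Sum>i\<in>J. c i * \<phi> i x))\<^sup>2)"
    by simp
  also have "\<dots> = integral\<^sup>L M (\<lambda>x. (f x)\<^sup>2) - (\<Sum>i\<in>J. 2 * c i * c i)
      + (\<Sum>i\<in>J. \<Sum>j\<in>J. c i * c j * (if i = j then 1 else 0))"
    unfolding eq by (simp add: assms c_def[symmetric] del: mult_eq_0_iff)
  also have "\<dots> = integral\<^sup>L M (\<lambda>x. (f x)\<^sup>2) - (\<Sum>i\<in>J. (c i)\<^sup>2)"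
    using \<open>finite J\<close> by (simp add: if_distrib sum.delta power2_eq_square mult.assoc sum_distrib_left[symmetric] cong: if_cong)
  finally show ?thesis
    by (simp add: c_def)
qed

section \<open>The normalising integral of the operator M\<close>

text \<open>The Gamma integral after the substitution v -> w v. Nonnegative integrals are used here
  so that the orders of integration can be exchanged later without checking integrability
  beforehand.\<close>

lemma nn_integral_powr_exp:
  fixes a w :: real assumes a: "0 < a" and w: "0 < w"
  shows "(\<integral>\<^sup>+v. ennreal (v powr (a - 1) * exp (- (v * w))) * indicator {0<..} v \<partial>lborel) = ennreal (Gamma a * w powr (- a))"
proof -
  have "ennreal (Gamma a) = (\<integral>\<^sup>+v. ennreal (indicator {0..} v * v powr (a - 1) / exp v) \<partial>lborel)"
    by (rule Gamma_conv_nn_integral_real[OF a])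
  also have "\<dots> = ennreal \<bar>w\<bar> * (\<integral>\<^sup>+v. ennreal (indicator {0..} (0 + w * v) * (0 + w * v) powr (a - 1) / exp (0 + w * v)) \<partial>lborel)"
    by (rule nn_integral_real_affine) (use w in auto)
  also have "\<dots> = (\<integral>\<^sup>+v. ennreal (w powr a) * (ennreal (v powr (a - 1) * exp (- (v * w))) * indicator {0<..} v) \<partial>lborel)"
  proof (subst nn_integral_cmult[symmetric], simp, rule nn_integral_cong)
    fix v :: real
    show "ennreal \<bar>w\<bar> * ennreal (indicator {0..} (0 + w * v) * (0 + w * v) powr (a - 1) / exp (0 + w * v)) =
        ennreal (w powr a) * (ennreal (v powr (a - 1) * exp (- (v * w))) * indicator {0<..} v)"
      using w a 
      by (cases "0 < v"; cases "v = 0")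
        (auto simp: indicator_def zero_le_mult_iff powr_mult powr_diff exp_minus field_simps simp flip: ennreal_mult')
  qed
  also have "\<dots> = ennreal (w powr a) * (\<integral>\<^sup>+v. ennreal (v powr (a - 1) * exp (- (v * w))) * indicator {0<..} v \<partial>lborel)"
    by (rule nn_integral_cmult) simp
  finally have "ennreal (w powr (- a)) * ennreal (Gamma a) = ennreal (w powr (- a)) * (ennreal (w powr a) *
      (\<integral>\<^sup>+v. ennreal (v powr (a - 1) * exp (- (v * w))) * indicator {0<..} v \<partial>lborel))"
    by simp
  also have "\<dots> = (\<integral>\<^sup>+v. ennreal (v powr (a - 1) * exp (- (v * w))) * indicator {0<..} v \<partial>lborel)"
    using w by (simp add: mult.assoc[symmetric] ennreal_mult'[symmetric] powr_add[symmetric])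
  finally have "(\<integral>\<^sup>+v. ennreal (v powr (a - 1) * exp (- (v * w))) * indicator {0<..} v \<partial>lborel)
      = ennreal (w powr (- a)) * ennreal (Gamma a)" ..
  then show ?thesis
    by (simp add: mult.commute flip: ennreal_mult'')
qed

lemma Gamma_reflection_real:
  fixes x :: real shows "Gamma x * Gamma (1 - x) = pi / sin (pi * x)"
proof -
  have "complex_of_real (Gamma x * Gamma (1 - x)) = complex_of_real (pi / sin (pi * x))"
  proof -
    have "complex_of_real (Gamma x * Gamma (1 - x)) = Gamma (of_real x) * Gamma (1 - of_real x)"
      using Gamma_complex_of_real[of "1 - x"] by (simp add: Gamma_complex_of_real)
    also have "\<dots> = of_real pi / sin (of_real pi * of_real x)"
      by (rule Gamma_reflection_complex)
    also have "\<dots> = complex_of_real (pi / sin (pi * x))"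
      by (simp add: sin_of_real[symmetric])
    finally show ?thesis .
  qed
  then show ?thesis by (simp only: of_real_eq_iff)
qed

text \<open>Write 1/(1 + v) as the integral of exp(-w (1 + v)) over w > 0 and exchange the order.
  The v-integral gives Gamma(H) w^(-H), the remaining w-integral gives Gamma(1 - H), and the
  reflection formula finishes.\<close>

lemma nn_integral_powr_div_1_plus:
  fixes H :: real assumes H: "0 < H" "H < 1"
  shows "(\<integral>\<^sup>+v. ennreal (v powr (H - 1) / (1 + v)) * indicator {0<..} v \<partial>lborel) = ennreal (pi / sin (pi * H))"
proof -
  have "(\<integral>\<^sup>+v. ennreal (v powr (H - 1) / (1 + v)) * indicator {0<..} v \<partial>lborel)
     = (\<integral>\<^sup>+v. (\<integral>\<^sup>+w. ennreal (v powr (H - 1) * exp (- (w * (1 + v)))) * indicator {0<..} w * indicator {0<..} v \<partial>lborel) \<partial>lborel)"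
  proof (rule nn_integral_cong)
    fix v :: real
    show "ennreal (v powr (H - 1) / (1 + v)) * indicator {0<..} v
      = (\<integral>\<^sup>+w. ennreal (v powr (H - 1) * exp (- (w * (1 + v)))) * indicator {0<..} w * indicator {0<..} v \<partial>lborel)"
    proof (cases "0 < v")
      case True
      have "(\<integral>\<^sup>+w. ennreal (exp (- (w * (1 + v)))) * indicator {0<..} w \<partial>lborel)
          = (\<integral>\<^sup>+w. ennreal (w powr (1 - 1) * exp (- (w * (1 + v)))) * indicator {0<..} w \<partial>lborel)"
        by (intro nn_integral_cong) (auto simp: indicator_def)
      also have "\<dots> = ennreal (1 / (1 + v))"
        using True by (subst nn_integral_powr_exp) (auto simp: powr_minus_divide)
      finally have "ennreal (v powr (H - 1)) * (\<integral>\<^sup>+w. ennreal (exp (- (w * (1 + v)))) * indicator {0<..} w \<partial>lborel)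
          = ennreal (v powr (H - 1) / (1 + v))"
        using True by (simp flip: ennreal_mult')
      then show ?thesis
        using True by (subst (asm) nn_integral_cmult[symmetric]) (auto simp: ennreal_mult' mult.assoc)
    qed simp
  qed
  also have "\<dots> = (\<integral>\<^sup>+w. (\<integral>\<^sup>+v. ennreal (v powr (H - 1) * exp (- (w * (1 + v)))) * indicator {0<..} w * indicator {0<..} v \<partial>lborel) \<partial>lborel)"
    by (rule lborel_pair.Fubini') measurable
  also have "\<dots> = (\<integral>\<^sup>+w. ennreal (Gamma H) * (ennreal (w powr ((1 - H) - 1) * exp (- (w * 1))) * indicator {0<..} w) \<partial>lborel)"
  proof (rule nn_integral_cong)
    fix w :: real
    show "(\<integral>\<^sup>+v. ennreal (v powr (H - 1) * exp (- (w * (1 + v)))) * indicator {0<..} w * indicator {0<..} v \<partial>lborel)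
      = ennreal (Gamma H) * (ennreal (w powr ((1 - H) - 1) * exp (- (w * 1))) * indicator {0<..} w)"
    proof (cases "0 < w")
      case True
      have "(\<integral>\<^sup>+v. ennreal (v powr (H - 1) * exp (- (w * (1 + v)))) * indicator {0<..} w * indicator {0<..} v \<partial>lborel)
        = (\<integral>\<^sup>+v. ennreal (exp (- w)) * (ennreal (v powr (H - 1) * exp (- (v * w))) * indicator {0<..} v) \<partial>lborel)"
      proof (rule nn_integral_cong)
        fix v :: real
        have "exp (- (w * (1 + v))) = exp (- w) * exp (- (v * w))"
          by (simp add: algebra_simps flip: exp_add)
        then show "ennreal (v powr (H - 1) * exp (- (w * (1 + v)))) * indicator {0<..} w * indicator {0<..} v
          = ennreal (exp (- w)) * (ennreal (v powr (H - 1) * exp (- (v * w))) * indicator {0<..} v)"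
          using True by (auto simp: indicator_def mult_ac simp flip: ennreal_mult')
      qed
      also have "\<dots> = ennreal (exp (- w)) * ennreal (Gamma H * w powr (- H))"
        using True H by (subst nn_integral_cmult) (auto simp: nn_integral_powr_exp)
      finally show ?thesis
        using True H Gamma_real_pos[of H] by (simp add: mult_ac flip: ennreal_mult')
    qed simp
  qed
  also have "\<dots> = ennreal (Gamma H) * ennreal (Gamma (1 - H) * 1 powr (- (1 - H)))"
    using H by (subst nn_integral_cmult, measurable, subst nn_integral_powr_exp) auto
  also have "\<dots> = ennreal (pi / sin (pi * H))"
    using H Gamma_reflection_real[of H] Gamma_real_pos[of H] by (simp flip: ennreal_mult')
  finally show ?thesis .
qed

text \<open>Substituting u = sqrt v turns this into half of the preceding integral. The substitution
  rule for nonnegative integrands also transfers integrability, from the v-integrand to the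
  u-integrand.\<close>

lemma nn_integral_powr_div_1_plus_square:
  fixes H :: real assumes H: "0 < H" "H < 1"
  shows "(\<integral>\<^sup>+u. ennreal (u powr (2 * H - 1) / (1 + u\<^sup>2)) * indicator {0<..} u \<partial>lborel) = ennreal (pi / (2 * sin (pi * H)))"
proof -
  have sin_pos: "0 < sin (pi * H)"
    using H by (intro sin_gt_zero) auto
  define f where "f v = v powr (H - 1) / (1 + v)" for v :: real
  define g where "g u = u powr (2 * H - 1) / (1 + u\<^sup>2)" for u :: real
  have f: "has_bochner_integral lborel (\<lambda>v. f v * indicator {0<..} v) (pi / sin (pi * H))"
  proof (rule has_bochner_integral_nn_integral)
    have "(\<integral>\<^sup>+ v. ennreal (f v * indicator {0<..} v) \<partial>lborel) = (\<integral>\<^sup>+v. ennreal (f v) * indicator {0<..} v \<partial>lborel)"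
      by (intro nn_integral_cong) (auto simp: indicator_def)
    then show "(\<integral>\<^sup>+ v. ennreal (f v * indicator {0<..} v) \<partial>lborel) = ennreal (pi / sin (pi * H))"
      using nn_integral_powr_div_1_plus[OF H] by (simp add: f_def)
  qed (use sin_pos in \<open>auto simp: f_def indicator_def\<close>)
  have ei: "einterval 0 \<infinity> = {0<..}"
    by (auto simp: einterval_def)
  have gf: "g (sqrt x) * inverse (sqrt x) = f x" if "0 < x" for x
  proof -
    have "sqrt x powr (2 * H - 1) * inverse (sqrt x) = x powr (H - 1)"
      using that by (simp add: powr_half_sqrt[symmetric] powr_powr powr_minus[symmetric] powr_add[symmetric] field_simps)
    then show ?thesis
      using that by (simp add: f_def g_def field_simps)
  qed
  have fi: "set_integrable lborel (einterval 0 \<infinity>) (\<lambda>x. g (sqrt x) * (inverse (sqrt x) / 2))"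
  proof -
    have "integrable lborel (\<lambda>v. f v * indicator {0<..} v / 2)"
      using integrable.intros[OF f] by simp
    also have "(\<lambda>v. f v * indicator {0<..} v / 2) = (\<lambda>x. indicator {0<..} x *\<^sub>R (g (sqrt x) * (inverse (sqrt x) / 2)))"
      by (auto simp: fun_eq_iff gf indicator_def)
    finally show ?thesis by (simp add: set_integrable_def ei)
  qed
  have A: "((ereal \<circ> sqrt \<circ> real_of_ereal) \<longlongrightarrow> 0) (at_right 0)"
  proof -
    have "((\<lambda>x. ereal (sqrt x)) \<longlongrightarrow> ereal (sqrt 0)) (at_right 0)"
      by (intro tendsto_intros)
    then have "((ereal \<circ> sqrt) \<longlongrightarrow> ereal 0) (at_right 0)"
      by (simp add: o_def)
    then show ?thesis
      unfolding zero_ereal_def by (simp add: ereal_tendsto_simps1)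
  qed
  have B: "((ereal \<circ> sqrt \<circ> real_of_ereal) \<longlongrightarrow> \<infinity>) (at_left \<infinity>)"
    by (simp add: ereal_tendsto_simps sqrt_at_top)
  have cont: "isCont g (sqrt x)" if "0 < ereal x" for x
  proof -
    have "1 + (sqrt x)\<^sup>2 \<noteq> 0" by (smt (verit) zero_le_power2)
    then show ?thesis
      unfolding g_def[abs_def] using that by (auto intro!: continuous_intros)
  qed
  have der: "DERIV sqrt x :> inverse (sqrt x) / 2" if "0 < ereal x" for x
    using that by (auto intro!: derivative_eq_intros)
  have cont': "isCont (\<lambda>x. inverse (sqrt x) / 2) x" if "0 < ereal x" for x
    using that by (auto intro!: continuous_intros)
  have nonneg: "0 \<le> g x" for x
    by (simp add: g_def)
  have pos: "0 \<le> inverse (sqrt x) / 2" if "0 \<le> ereal x" for x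
    using that by simp
  note sub = interval_integral_substitution_nonneg[of 0 \<infinity> sqrt "\<lambda>x. inverse (sqrt x) / 2" g 0 \<infinity>,
      OF _ der cont cont' nonneg pos A B fi]
  have set_int: "set_integrable lborel (einterval 0 \<infinity>) g"
    by (rule sub(1)) auto
  have gi: "integrable lborel (\<lambda>u. g u * indicator {0<..} u)"
    using set_int by (simp add: set_integrable_def ei mult.commute)
  have "(\<integral>\<^sup>+u. ennreal (g u) * indicator {0<..} u \<partial>lborel) = (\<integral>\<^sup>+u. ennreal (g u * indicator {0<..} u) \<partial>lborel)"
    by (intro nn_integral_cong) (auto simp: indicator_def)
  also have "\<dots> = ennreal (integral\<^sup>L lborel (\<lambda>u. g u * indicator {0<..} u))"
    by (rule nn_integral_eq_integral[OF gi]) (auto simp: g_def indicator_def)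
  also have "integral\<^sup>L lborel (\<lambda>u. g u * indicator {0<..} u) = (LBINT x=0..\<infinity>. g x)"
    by (simp add: interval_lebesgue_integral_def set_lebesgue_integral_def ei mult.commute)
  also have "\<dots> = (LBINT x=0..\<infinity>. g (sqrt x) * (inverse (sqrt x) / 2))"
    by (rule sub(2)) auto
  also have "\<dots> = integral\<^sup>L lborel (\<lambda>v. f v * indicator {0<..} v / 2)"
    by (simp add: interval_lebesgue_integral_def set_lebesgue_integral_def ei,
        intro Bochner_Integration.integral_cong refl) (use gf in \<open>auto simp: indicator_def\<close>)
  also have "\<dots> = pi / (2 * sin (pi * H))"
    using has_bochner_integral_integral_eq[OF f] by simp
  finally show ?thesis by (simp add: g_def)
qed

lemma nn_integral_1_minus_cos_exp:
  fixes u :: real assumes u: "0 < u"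
  shows "(\<integral>\<^sup>+y. ennreal ((1 - cos y) * exp (- (u * y))) * indicator {0<..} y \<partial>lborel) = ennreal (1 / (u * (1 + u\<^sup>2)))"
proof -
  define k where "k = 1 / (1 + u\<^sup>2)"
  \<comment> \<open>The two summands are antiderivatives of exp(-u y) and of -exp(-u y) cos
    y.\<close>
  define F where "F y = - exp (- (u * y)) / u - exp (- (u * y)) * (sin y - u * cos y) * k" for y
  have nz: "1 + u\<^sup>2 \<noteq> 0"
    by (smt (verit) zero_le_power2)
  \<comment> \<open>The integrand is 0 at y = 0, or excluded there, so the closed half-line required
    by the fundamental theorem gives the same integral.\<close>
  have "(\<integral>\<^sup>+y. ennreal ((1 - cos y) * exp (- (u * y))) * indicator {0<..} y \<partial>lborel)
      = (\<integral>\<^sup>+y. ennreal ((1 - cos y) * exp (- (u * y))) * indicator {0..} y \<partial>lborel)"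
    by (intro nn_integral_cong) (auto simp: indicator_def)
  also have "\<dots> = ennreal (0 - F 0)"
  proof (rule nn_integral_FTC_atLeast)
    show "(F has_real_derivative (1 - cos x) * exp (- (u * x))) (at x)" for x
    proof -
      define e where "e = exp (- (u * x))"
      have "(F has_real_derivative (e - ((e * (- u)) * (sin x - u * cos x) + e * (cos x + u * sin x)) * k)) (at x)"
        unfolding F_def e_def using u by (auto intro!: derivative_eq_intros simp: algebra_simps)
      also have "e - ((e * (- u)) * (sin x - u * cos x) + e * (cos x + u * sin x)) * k = e - e * cos x * (k * (1 + u\<^sup>2))"
        by (simp add: algebra_simps power2_eq_square)
      also have "\<dots> = (1 - cos x) * e"
        using nz by (simp add: k_def algebra_simps)
      finally show ?thesis by (simp add: e_def)
    qed
    have e: "((\<lambda>y. exp (- (u * y))) \<longlongrightarrow> 0) at_top"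
      using u by real_asymp
    have b: "((\<lambda>y. exp (- (u * y)) * (sin y - u * cos y)) \<longlongrightarrow> 0) at_top"
    proof (rule Lim_null_comparison)
      show "((\<lambda>y. exp (- (u * y)) * (1 + u)) \<longlongrightarrow> 0) at_top"
        using u by real_asymp
      show "\<forall>\<^sub>F y in at_top. norm (exp (- (u * y)) * (sin y - u * cos y)) \<le> exp (- (u * y)) * (1 + u)"
      proof (intro always_eventually allI)
        fix y :: real
        have "\<bar>sin y - u * cos y\<bar> \<le> \<bar>sin y\<bar> + u * \<bar>cos y\<bar>"
          using u by (metis abs_mult abs_of_pos abs_triangle_ineq4)
        also have "\<dots> \<le> 1 + u"
          using u mult_left_le[of "\<bar>cos y\<bar>" u] by (intro add_mono) auto
        finally show "norm (exp (- (u * y)) * (sin y - u * cos y)) \<le> exp (- (u * y)) * (1 + u)"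
          by (simp add: abs_mult)
      qed
    qed
    show "(F \<longlongrightarrow> 0) at_top"
      unfolding F_def
      using tendsto_diff[OF tendsto_divide[OF tendsto_minus[OF e] tendsto_const[of u]] tendsto_mult_right[OF b, of k]] u
      by simp
  qed auto
  also have "0 - F 0 = 1 / (u * (1 + u\<^sup>2))"
    using u nz by (simp add: F_def k_def field_simps power2_eq_square)
  finally show ?thesis .
qed

text \<open>Write \<open>y powr (- 1 - 2 * H)\<close> as a Gamma integral \<open>\<integral> u powr (2 * H) * exp (- u * y) du / Gamma (2 * H + 1)\<close>
  and integrate over \<open>y\<close> first.\<close>
lemma nn_integral_1_minus_cos_powr:
  fixes H :: real assumes H: "0 < H" "H < 1"
  shows "(\<integral>\<^sup>+y. ennreal ((1 - cos y) * y powr (- 1 - 2 * H)) * indicator {0<..} y \<partial>lborel)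
    = ennreal (pi / (2 * Gamma (2 * H + 1) * sin (pi * H)))"
proof -
  have G: "Gamma (2 * H + 1) > 0"
    using H by (intro Gamma_real_pos) auto
  have sin_pos: "0 < sin (pi * H)"
    using H by (intro sin_gt_zero) auto
  have "ennreal (Gamma (2 * H + 1)) * (\<integral>\<^sup>+y. ennreal ((1 - cos y) * y powr (- 1 - 2 * H)) * indicator {0<..} y \<partial>lborel)
    = (\<integral>\<^sup>+y. (\<integral>\<^sup>+u. ennreal ((1 - cos y) * u powr (2 * H) * exp (- (u * y))) * indicator {0<..} u * indicator {0<..} y \<partial>lborel) \<partial>lborel)"
  proof (subst nn_integral_cmult[symmetric], measurable, rule nn_integral_cong)
    fix y :: real
    show "ennreal (Gamma (2 * H + 1)) * (ennreal ((1 - cos y) * y powr (- 1 - 2 * H)) * indicator {0<..} y)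
      = (\<integral>\<^sup>+u. ennreal ((1 - cos y) * u powr (2 * H) * exp (- (u * y))) * indicator {0<..} u * indicator {0<..} y \<partial>lborel)"
    proof (cases "0 < y")
      case True
      have "(\<integral>\<^sup>+u. ennreal ((1 - cos y) * u powr (2 * H) * exp (- (u * y))) * indicator {0<..} u * indicator {0<..} y \<partial>lborel)
        = (\<integral>\<^sup>+u. ennreal (1 - cos y) * (ennreal (u powr ((2 * H + 1) - 1) * exp (- (u * y))) * indicator {0<..} u) \<partial>lborel)"
        using True by (intro nn_integral_cong) (auto simp: indicator_def mult.assoc simp flip: ennreal_mult')
      also have "\<dots> = ennreal (1 - cos y) * (\<integral>\<^sup>+u. ennreal (u powr ((2 * H + 1) - 1) * exp (- (u * y))) * indicator {0<..} u \<partial>lborel)"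
        by (rule nn_integral_cmult) measurable
      also have "(\<integral>\<^sup>+u. ennreal (u powr ((2 * H + 1) - 1) * exp (- (u * y))) * indicator {0<..} u \<partial>lborel)
          = ennreal (Gamma (2 * H + 1) * y powr (- (2 * H + 1)))"
        using True H by (intro nn_integral_powr_exp) auto
      also have "- (2 * H + 1) = - 1 - 2 * H"
        by simp
      finally show ?thesis
        using True G by (simp add: mult_ac diff_diff_eq flip: ennreal_mult')
    qed simp
  qed
  also have "\<dots> = (\<integral>\<^sup>+u. (\<integral>\<^sup>+y. ennreal ((1 - cos y) * u powr (2 * H) * exp (- (u * y))) * indicator {0<..} u * indicator {0<..} y \<partial>lborel) \<partial>lborel)"
    by (rule lborel_pair.Fubini') measurable
  also have "\<dots> = (\<integral>\<^sup>+u. ennreal (u powr (2 * H - 1) / (1 + u\<^sup>2)) * indicator {0<..} u \<partial>lborel)"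
  proof (rule nn_integral_cong)
    fix u :: real
    show "(\<integral>\<^sup>+y. ennreal ((1 - cos y) * u powr (2 * H) * exp (- (u * y))) * indicator {0<..} u * indicator {0<..} y \<partial>lborel)
      = ennreal (u powr (2 * H - 1) / (1 + u\<^sup>2)) * indicator {0<..} u"
    proof (cases "0 < u")
      case True
      have "(\<integral>\<^sup>+y. ennreal ((1 - cos y) * u powr (2 * H) * exp (- (u * y))) * indicator {0<..} u * indicator {0<..} y \<partial>lborel)
        = (\<integral>\<^sup>+y. ennreal (u powr (2 * H)) * (ennreal ((1 - cos y) * exp (- (u * y))) * indicator {0<..} y) \<partial>lborel)"
        using True by (intro nn_integral_cong) (auto simp: indicator_def mult_ac simp flip: ennreal_mult')
      also have "\<dots> = ennreal (u powr (2 * H)) * ennreal (1 / (u * (1 + u\<^sup>2)))"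
        using nn_integral_1_minus_cos_exp[OF True] by (subst nn_integral_cmult) auto
      finally show ?thesis
        using True by (simp add: powr_diff mult_ac flip: ennreal_mult')
    qed simp
  qed
  also have "\<dots> = ennreal (pi / (2 * sin (pi * H)))"
    by (rule nn_integral_powr_div_1_plus_square[OF H])
  finally have *: "ennreal (Gamma (2 * H + 1)) * (\<integral>\<^sup>+y. ennreal ((1 - cos y) * y powr (- 1 - 2 * H)) * indicator {0<..} y \<partial>lborel)
      = ennreal (pi / (2 * sin (pi * H)))" .
  have inv: "ennreal (1 / Gamma (2 * H + 1)) * ennreal (Gamma (2 * H + 1)) = 1"
    using G by (simp flip: ennreal_mult')
  have "(\<integral>\<^sup>+y. ennreal ((1 - cos y) * y powr (- 1 - 2 * H)) * indicator {0<..} y \<partial>lborel)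
      = ennreal (1 / Gamma (2 * H + 1)) * ennreal (pi / (2 * sin (pi * H)))"
    unfolding *[symmetric] mult.assoc[symmetric] inv by (rule mult_1[symmetric])
  also have "\<dots> = ennreal (1 / Gamma (2 * H + 1) * (pi / (2 * sin (pi * H))))"
    using G by (intro ennreal_mult'[symmetric]) simp
  finally show ?thesis
    by (simp add: mult_ac)
qed

text \<open>Substituting t y for y, the Jacobian and the power combine to t^(2H). This is the
  self-similarity behind the norm t^H.\<close>

lemma nn_integral_1_minus_cos_powr_scaled:
  fixes H t :: real assumes H: "0 < H" "H < 1" and t: "0 < t"
  shows "(\<integral>\<^sup>+y. ennreal ((1 - cos (t * y)) * y powr (- 1 - 2 * H)) * indicator {0<..} y \<partial>lborel)
    = ennreal (t powr (2 * H) * pi / (2 * Gamma (2 * H + 1) * sin (pi * H)))"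
proof -
  have "ennreal (pi / (2 * Gamma (2 * H + 1) * sin (pi * H)))
      = ennreal \<bar>t\<bar> * (\<integral>\<^sup>+y. ennreal ((1 - cos (0 + t * y)) * (0 + t * y) powr (- 1 - 2 * H)) * indicator {0<..} (0 + t * y) \<partial>lborel)"
    unfolding nn_integral_1_minus_cos_powr[OF H, symmetric]
    by (rule nn_integral_real_affine) (use t in auto)
  also have "\<dots> = (\<integral>\<^sup>+y. ennreal (t powr (- 2 * H)) * (ennreal ((1 - cos (t * y)) * y powr (- 1 - 2 * H)) * indicator {0<..} y) \<partial>lborel)"
  proof (subst nn_integral_cmult[symmetric], measurable, rule nn_integral_cong)
    fix y :: real
    have pw: "t * t powr (- 1 - H * 2) = t powr - (H * 2)"
      using t by (simp add: powr_mult_base)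
    show "ennreal \<bar>t\<bar> * (ennreal ((1 - cos (0 + t * y)) * (0 + t * y) powr (- 1 - 2 * H)) * indicator {0<..} (0 + t * y))
      = ennreal (t powr (- 2 * H)) * (ennreal ((1 - cos (t * y)) * y powr (- 1 - 2 * H)) * indicator {0<..} y)"
      using t pw by (cases "0 < y")
        (auto simp: powr_mult indicator_def zero_less_mult_iff mult_ac simp flip: ennreal_mult')
  qed
  also have "\<dots> = ennreal (t powr (- 2 * H)) * (\<integral>\<^sup>+y. ennreal ((1 - cos (t * y)) * y powr (- 1 - 2 * H)) * indicator {0<..} y \<partial>lborel)"
    by (rule nn_integral_cmult) measurable
  finally have *: "ennreal (pi / (2 * Gamma (2 * H + 1) * sin (pi * H)))
      = ennreal (t powr (- 2 * H)) * (\<integral>\<^sup>+y. ennreal ((1 - cos (t * y)) * y powr (- 1 - 2 * H)) * indicator {0<..} y \<partial>lborel)" .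
  have pw: "ennreal (t powr (2 * H)) * ennreal (t powr (- 2 * H)) = 1"
    using t by (simp flip: ennreal_mult' powr_add)
  have "ennreal (t powr (2 * H)) * ennreal (pi / (2 * Gamma (2 * H + 1) * sin (pi * H)))
      = (\<integral>\<^sup>+y. ennreal ((1 - cos (t * y)) * y powr (- 1 - 2 * H)) * indicator {0<..} y \<partial>lborel)"
    unfolding * mult.assoc[symmetric] pw by (rule mult_1)
  then show ?thesis
    by (simp flip: ennreal_mult')
qed

section \<open>The norm of the transformed indicator\<close>

lemma fourier_indicator:
  assumes "0 \<le> t" "y \<noteq> 0"
  shows "fourier (indicator {0..t}) y = (1 - cis (- (t * y))) / (\<i> * y)"
proof -
  define F where "F x = - cis (- (x * y)) / (\<i> * y)" for x
  have "fourier (indicator {0..t}) y = integral\<^sup>L lborel (\<lambda>x. indicator {0..t} x *\<^sub>R cis (- (x * y)))"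
    unfolding fourier_def by (intro Bochner_Integration.integral_cong) (auto simp: indicator_def)
  also have "\<dots> = F t - F 0"
  proof (rule integral_FTC_atLeastAtMost)
    show "(F has_vector_derivative cis (- (x * y))) (at x within {0..t})" for x
    proof -
      have "((\<lambda>x. (- 1 / (\<i> * y)) * cis (- (x * y))) has_vector_derivative (- 1 / (\<i> * y)) * (- \<i> * y * cis (- (x * y)))) (at x within {0..t})"
        by (intro has_vector_derivative_mult_right has_vector_derivative_cis_neg_mult)
      then show ?thesis using assms by (simp add: F_def[abs_def])
    qed
    show "continuous_on {0..t} (\<lambda>x. cis (- (x * y)))"
      unfolding cis_conv_exp by (intro continuous_intros)
  qed fact
  also have "\<dots> = (1 - cis (- (t * y))) / (\<i> * y)"
    by (simp add: F_def diff_divide_distrib)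
  finally show ?thesis .
qed

lemma norm_fourier_indicator:
  assumes "0 \<le> t" "y \<noteq> 0"
  shows "(cmod (fourier (indicator {0..t}) y))\<^sup>2 = 2 * (1 - cos (t * y)) / y\<^sup>2"
proof -
  have "(1 - cos (t * y))\<^sup>2 + (sin (t * y))\<^sup>2 = 2 * (1 - cos (t * y))"
    using sin_cos_squared_add[of "t * y"] by (simp add: power2_eq_square algebra_simps)
  then show ?thesis
    by (simp add: fourier_indicator[OF assms] norm_divide norm_mult power_divide cmod_power2)
qed

text \<open>The exponents 1 - 2H of the squared multiplier and -2 of the squared transform add up to
  -1 - 2H, and 2 pi / c_H^2 = Gamma(2H + 1) sin(pi H). At y = 0 both sides are 0, since
  \<open>0 powr r = 0\<close>.\<close>

lemma norm_MH_ind_hat: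
  assumes H: "0 < H" "H < 1" and t: "0 < t"
  shows "(cmod (MH_ind_hat H t y))\<^sup>2
    = 2 * (Gamma (2 * H + 1) * sin (pi * H)) * ((1 - cos (t * \<bar>y\<bar>)) * \<bar>y\<bar> powr (- 1 - 2 * H))"
proof (cases "y = 0")
  case False
  have G: "Gamma (2 * H + 1) > 0"
    using H by (intro Gamma_real_pos) auto
  have sin_pos: "0 < sin (pi * H)"
    using H by (intro sin_gt_zero) auto
  have "(cmod (MH_ind_hat H t y))\<^sup>2 = (sqrt (2 * pi) / c_const H)\<^sup>2 * (\<bar>y\<bar> powr (1/2 - H))\<^sup>2 * (2 * (1 - cos (t * y)) / y\<^sup>2)"
    using norm_fourier_indicator[of t y] t False unfolding MH_ind_hat_def
    by (simp add: norm_mult power_mult_distrib norm_divide power_divide)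
  also have "(sqrt (2 * pi) / c_const H)\<^sup>2 = Gamma (2 * H + 1) * sin (pi * H)"
    using G sin_pos by (simp add: c_const_def power_divide)
  also have "(\<bar>y\<bar> powr (1/2 - H))\<^sup>2 = \<bar>y\<bar> powr (1 - 2 * H)"
    using False by (simp add: power2_eq_square flip: powr_add)
  also have "2 * (1 - cos (t * y)) / y\<^sup>2 = 2 * (1 - cos (t * \<bar>y\<bar>)) * \<bar>y\<bar> powr (- 2)"
  proof -
    have "cos (t * \<bar>y\<bar>) = cos (t * y)"
      by (simp add: abs_if)
    moreover have "\<bar>y\<bar> powr (- 2) = 1 / y\<^sup>2"
      using False by (simp add: powr_minus_divide)
    ultimately show ?thesis by simp
  qed
  also have "Gamma (2 * H + 1) * sin (pi * H) * \<bar>y\<bar> powr (1 - 2 * H) * (2 * (1 - cos (t * \<bar>y\<bar>)) * \<bar>y\<bar> powr (- 2))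
      = 2 * (Gamma (2 * H + 1) * sin (pi * H)) * ((1 - cos (t * \<bar>y\<bar>)) * (\<bar>y\<bar> powr (1 - 2 * H) * \<bar>y\<bar> powr (- 2)))"
    by (simp add: mult_ac)
  also have "\<bar>y\<bar> powr (1 - 2 * H) * \<bar>y\<bar> powr (- 2) = \<bar>y\<bar> powr (- 1 - 2 * H)"
    by (simp flip: powr_add)
  finally show ?thesis .
qed (simp add: MH_ind_hat_def)

lemma borel_measurable_cis [measurable (raw)]:
  "f \<in> borel_measurable M \<Longrightarrow> (\<lambda>x. cis (f x)) \<in> borel_measurable M"
  unfolding cis_conv_exp by measurable

lemma borel_measurable_MH_ind_hat [measurable]: "MH_ind_hat H t \<in> borel_measurable borel"
  unfolding MH_ind_hat_def fourier_def by measurable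

lemma nn_integral_even:
  fixes f :: "real \<Rightarrow> ennreal"
  assumes [measurable]: "f \<in> borel_measurable borel" and "f 0 = 0"
  shows "(\<integral>\<^sup>+y. f \<bar>y\<bar> \<partial>lborel) = 2 * (\<integral>\<^sup>+y. f y * indicator {0<..} y \<partial>lborel)"
proof -
  have "(\<integral>\<^sup>+y. f \<bar>y\<bar> \<partial>lborel) = (\<integral>\<^sup>+y. f y * indicator {0<..} y + f (- y) * indicator {0<..} (- y) \<partial>lborel)"
    using assms(2) by (intro nn_integral_cong) (auto simp: indicator_def abs_if)
  also have "\<dots> = (\<integral>\<^sup>+y. f y * indicator {0<..} y \<partial>lborel) + (\<integral>\<^sup>+y. f (- y) * indicator {0<..} (- y) \<partial>lborel)"
    by (rule nn_integral_add) measurable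
  also have "(\<integral>\<^sup>+y. f (- y) * indicator {0<..} (- y) \<partial>lborel) = (\<integral>\<^sup>+y. f y * indicator {0<..} y \<partial>lborel)"
    by (subst nn_integral_real_affine[of "\<lambda>y. f y * indicator {0<..} y" "- 1" 0]) auto
  finally show ?thesis
    by (simp add: mult_2)
qed

text \<open>The normalisation by \<open>c_const\<close> is the one that cancels the Gamma and sine
  factors of the cosine integral. What remains is 2 pi times t^(2H), the variance of fractional
  Brownian motion at time t.\<close>

lemma nn_integral_MH_ind_hat:
  assumes H: "0 < H" "H < 1" and t: "0 < t"
  shows "(\<integral>\<^sup>+y. ennreal ((cmod (MH_ind_hat H t y))\<^sup>2) \<partial>lborel) = ennreal (2 * pi * t powr (2 * H))"
proof -
  have G: "Gamma (2 * H + 1) > 0"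
    using H by (intro Gamma_real_pos) auto
  have sin_pos: "0 < sin (pi * H)"
    using H by (intro sin_gt_zero) auto
  define K where "K = 2 * (Gamma (2 * H + 1) * sin (pi * H))"
  have K: "K > 0" using G sin_pos by (simp add: K_def)
  define g where "g y = ennreal ((1 - cos (t * y)) * y powr (- 1 - 2 * H))" for y
  have [measurable]: "g \<in> borel_measurable borel"
    unfolding g_def[abs_def] by measurable
  have "(\<integral>\<^sup>+y. ennreal ((cmod (MH_ind_hat H t y))\<^sup>2) \<partial>lborel) = (\<integral>\<^sup>+y. ennreal K * g \<bar>y\<bar> \<partial>lborel)"
    using K by (intro nn_integral_cong) (simp add: norm_MH_ind_hat[OF assms] g_def K_def ennreal_mult')
  also have "\<dots> = ennreal K * (\<integral>\<^sup>+y. g \<bar>y\<bar> \<partial>lborel)"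
    by (rule nn_integral_cmult) measurable
  also have "(\<integral>\<^sup>+y. g \<bar>y\<bar> \<partial>lborel) = 2 * (\<integral>\<^sup>+y. g y * indicator {0<..} y \<partial>lborel)"
    by (rule nn_integral_even) (auto simp: g_def)
  also have "(\<integral>\<^sup>+y. g y * indicator {0<..} y \<partial>lborel) = ennreal (t powr (2 * H) * pi / (2 * Gamma (2 * H + 1) * sin (pi * H)))"
    unfolding g_def by (rule nn_integral_1_minus_cos_powr_scaled[OF assms])
  also have "ennreal K * (2 * ennreal (t powr (2 * H) * pi / (2 * Gamma (2 * H + 1) * sin (pi * H))))
    = ennreal (K * (2 * (t powr (2 * H) * pi / (2 * Gamma (2 * H + 1) * sin (pi * H)))))"
  proof -
    have "ennreal K * (2 * ennreal r) = ennreal (K * (2 * r))" for r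
      using K by (simp add: ennreal_mult' ennreal_mult'[of 2])
    then show ?thesis .
  qed
  also have "K * (2 * (t powr (2 * H) * pi / (2 * Gamma (2 * H + 1) * sin (pi * H)))) = 2 * pi * t powr (2 * H)"
    using G sin_pos by (simp add: K_def field_simps)
  finally show ?thesis .
qed

section \<open>Hermite coefficients of the transformed indicator\<close>

lemma borel_measurable_hermite_poly [measurable]: "hermite_poly k \<in> borel_measurable borel"
proof -
  have "poly (hermite k) \<in> borel_measurable borel"
    by (intro borel_measurable_continuous_onI continuous_intros)
  also have "poly (hermite k) = hermite_poly k"
    by (simp add: fun_eq_iff poly_hermite)
  finally show ?thesis .
qed

lemma borel_measurable_hermite_fun [measurable]: "hermite_fun k \<in> borel_measurable borel"
  unfolding hermite_fun_def[abs_def] by measurable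

lemma integrable_mult_of_squares:
  fixes f g :: "'a \<Rightarrow> real"
  assumes [measurable]: "f \<in> borel_measurable M" "g \<in> borel_measurable M"
    and "integrable M (\<lambda>x. (f x)\<^sup>2)" "integrable M (\<lambda>x. (g x)\<^sup>2)"
  shows "integrable M (\<lambda>x. f x * g x)"
proof (rule Bochner_Integration.integrable_bound)
  show "integrable M (\<lambda>x. (f x)\<^sup>2 + (g x)\<^sup>2)"
    using assms by simp
  show "AE x in M. norm (f x * g x) \<le> norm ((f x)\<^sup>2 + (g x)\<^sup>2)"
  proof (intro AE_I2)
    fix x
    have "2 * \<bar>f x * g x\<bar> \<le> (f x)\<^sup>2 + (g x)\<^sup>2"
      using sum_squares_bound[of "\<bar>f x\<bar>" "\<bar>g x\<bar>"] by (simp add: abs_mult)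
    then show "norm (f x * g x) \<le> norm ((f x)\<^sup>2 + (g x)\<^sup>2)"
      by simp
  qed
qed measurable

text \<open>Bessel's inequality is real, so it is applied to the real and imaginary parts of the
  transform separately, with Hermite coefficients \<open>A j\<close> and \<open>B j\<close>. The
  modulus sqrt(2 pi) of the eigenvalues, the divisor 2 pi in \<open>MH_coeff\<close> and the 2 pi in
  the norm of the transform cancel.\<close>

lemma sum_MH_coeff_le:
  assumes H: "0 < H" "H < 1" and t: "0 < t" and "finite J"
  shows "(\<Sum>j\<in>J. (MH_coeff H t j)\<^sup>2) \<le> t powr (2 * H)"
proof -
  define G where "G = MH_ind_hat H t"
  define A where "A j = integral\<^sup>L lborel (\<lambda>y. Re (G y) * hermite_fun j y)" for j
  define B where "B j = integral\<^sup>L lborel (\<lambda>y. Im (G y) * hermite_fun j y)" for j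
  have [measurable]: "G \<in> borel_measurable borel"
    by (simp add: G_def)
  have G2: "has_bochner_integral lborel (\<lambda>y. (cmod (G y))\<^sup>2) (2 * pi * t powr (2 * H))"
    using nn_integral_MH_ind_hat[OF H t] by (intro has_bochner_integral_nn_integral) (auto simp: G_def)
  have Re2: "integrable lborel (\<lambda>y. (Re (G y))\<^sup>2)"
    by (rule Bochner_Integration.integrable_bound[OF integrable.intros[OF G2]]) (auto simp: cmod_power2)
  have Im2: "integrable lborel (\<lambda>y. (Im (G y))\<^sup>2)"
    by (rule Bochner_Integration.integrable_bound[OF integrable.intros[OF G2]]) (auto simp: cmod_power2)
  have intA: "integrable lborel (\<lambda>y. Re (G y) * hermite_fun j y)"
   and intB: "integrable lborel (\<lambda>y. Im (G y) * hermite_fun j y)" for j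
    by (intro integrable_mult_of_squares Re2 Im2 integrable_hermite_fun_square; measurable)+
  have "(MH_coeff H t j)\<^sup>2 \<le> ((A j)\<^sup>2 + (B j)\<^sup>2) / (2 * pi)" for j
  proof -
    define I where "I = integral\<^sup>L lborel (\<lambda>y. G y * cnj (fourier (hermite_fun j) y))"
    have "I = integral\<^sup>L lborel (\<lambda>y. (sqrt (2 * pi) * \<i> ^ j) * (complex_of_real (Re (G y) * hermite_fun j y) + \<i> * complex_of_real (Im (G y) * hermite_fun j y)))"
      unfolding I_def
    proof (intro Bochner_Integration.integral_cong refl)
      fix y
      have "complex_of_real (Re (G y) * hermite_fun j y) + \<i> * complex_of_real (Im (G y) * hermite_fun j y) = G y * hermite_fun j y"
        by (simp add: complex_eq_iff)
      then show "G y * cnj (fourier (hermite_fun j) y) = (sqrt (2 * pi) * \<i> ^ j) * (complex_of_real (Re (G y) * hermite_fun j y) + \<i> * complex_of_real (Im (G y) * hermite_fun j y))"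
        by (simp add: fourier_hermite_fun)
    qed
    also have "\<dots> = (sqrt (2 * pi) * \<i> ^ j) * (complex_of_real (A j) + \<i> * complex_of_real (B j))"
      using integrable_of_real[OF intA[of j]] integrable_of_real[OF intB[of j]]
      by (subst integral_mult_right_zero, subst Bochner_Integration.integral_add)
         (auto simp: A_def B_def simp flip: of_real_mult)
    finally have I: "I = (sqrt (2 * pi) * \<i> ^ j) * (complex_of_real (A j) + \<i> * complex_of_real (B j))" .
    have "cmod I = sqrt (2 * pi) * cmod (complex_of_real (A j) + \<i> * complex_of_real (B j))"
      unfolding I by (simp add: norm_mult norm_power del: complex_of_real_i)
    then have "(cmod I)\<^sup>2 = 2 * pi * ((A j)\<^sup>2 + (B j)\<^sup>2)"
      by (simp add: power_mult_distrib cmod_power2)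
    moreover have "MH_coeff H t j = Re I / (2 * pi)"
      unfolding MH_coeff_def I_def G_def[symmetric] 
      by (metis Re_divide_of_real integral_divide_zero)
    moreover have "(Re I)\<^sup>2 \<le> (cmod I)\<^sup>2"
      by (simp add: cmod_power2)
    ultimately have "(MH_coeff H t j)\<^sup>2 \<le> 2 * pi * ((A j)\<^sup>2 + (B j)\<^sup>2) / (2 * pi)\<^sup>2"
      by (simp only: power_divide) (rule divide_right_mono, auto)
    also have "\<dots> = ((A j)\<^sup>2 + (B j)\<^sup>2) / (2 * pi)"
      by (simp add: power2_eq_square field_simps)
    finally show ?thesis .
  qed
  then have "(\<Sum>j\<in>J. (MH_coeff H t j)\<^sup>2) \<le> (\<Sum>j\<in>J. ((A j)\<^sup>2 + (B j)\<^sup>2) / (2 * pi))"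
    by (rule sum_mono)
  also have "\<dots> = ((\<Sum>j\<in>J. (A j)\<^sup>2) + (\<Sum>j\<in>J. (B j)\<^sup>2)) / (2 * pi)"
    by (simp only: sum_divide_distrib[symmetric] sum.distrib)
  also have "\<dots> \<le> (integral\<^sup>L lborel (\<lambda>y. (Re (G y))\<^sup>2) + integral\<^sup>L lborel (\<lambda>y. (Im (G y))\<^sup>2)) / (2 * pi)"
    unfolding A_def B_def using \<open>finite J\<close> Re2 Im2 intA intB integrable_hermite_fun_mult integral_hermite_fun_mult
    by (intro divide_right_mono add_mono bessel_inequality) auto
  also have "integral\<^sup>L lborel (\<lambda>y. (Re (G y))\<^sup>2) + integral\<^sup>L lborel (\<lambda>y. (Im (G y))\<^sup>2) = integral\<^sup>L lborel (\<lambda>y. (cmod (G y))\<^sup>2)"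
    using Re2 Im2 by (simp add: cmod_power2)
  also have "\<dots> = 2 * pi * t powr (2 * H)"
    by (rule has_bochner_integral_integral_eq[OF G2])
  finally show ?thesis by simp
qed

lemma MH_ind_norm_sq_bounds:
  assumes H: "0 < H" "H < 1" and t: "0 < t"
  shows "0 \<le> MH_ind_norm_sq p H t" "MH_ind_norm_sq p H t \<le> t powr (2 * H) / 4 ^ p"
proof -
  have sm: "summable (\<lambda>j. (MH_coeff H t j)\<^sup>2)"
    by (rule summableI_nonneg_bounded[where x = "t powr (2 * H)"]) (auto intro: sum_MH_coeff_le[OF assms])
  have le: "(MH_coeff H t j)\<^sup>2 / (2 * real j + 2) ^ (2 * p) \<le> (MH_coeff H t j)\<^sup>2 / 4 ^ p" for j
  proof -
    have "(4::real) ^ p = 2 ^ (2 * p)" by (simp add: power_mult)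
    also have "\<dots> \<le> (2 * real j + 2) ^ (2 * p)" by (intro power_mono) auto
    finally show ?thesis by (intro divide_left_mono) auto
  qed
  have sm': "summable (\<lambda>j. (MH_coeff H t j)\<^sup>2 / (2 * real j + 2) ^ (2 * p))"
    by (rule summable_comparison_test'[OF summable_divide[OF sm, of "4 ^ p"]]) (use le in auto)
  show "0 \<le> MH_ind_norm_sq p H t"
    unfolding MH_ind_norm_sq_def by (rule suminf_nonneg[OF sm']) auto
  have "MH_ind_norm_sq p H t \<le> (\<Sum>j. (MH_coeff H t j)\<^sup>2 / 4 ^ p)"
    unfolding MH_ind_norm_sq_def by (intro suminf_le le sm' summable_divide sm)
  also have "\<dots> = (\<Sum>j. (MH_coeff H t j)\<^sup>2) / 4 ^ p"
    by (rule suminf_divide[OF sm])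
  also have "\<dots> \<le> t powr (2 * H) / 4 ^ p"
    by (intro divide_right_mono suminf_le_const sm sum_MH_coeff_le[OF assms]) auto
  finally show "MH_ind_norm_sq p H t \<le> t powr (2 * H) / 4 ^ p" .
qed

section \<open>Hermite coefficients of the test functions\<close>

definition dilated_hermite_fun :: "real \<Rightarrow> nat \<Rightarrow> real \<Rightarrow> real" where
  "dilated_hermite_fun s k x = hermite_fun k (x / s) / sqrt s"

text \<open>The scale \<open>s\<close> stands for \<open>sqrt 2 * t powr H\<close>; this is \<open>xi_fun t H k\<close> without its factor
  \<open>sqrt (fact k) * t powr (k * H)\<close>.\<close>
definition normalized_xi :: "real \<Rightarrow> nat \<Rightarrow> real \<Rightarrow> real" where
  "normalized_xi s k x = hermite_poly k (x / s) * exp (- (x / s)\<^sup>2) / sqrt (2 ^ k * fact k)"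

definition xi_coeff :: "real \<Rightarrow> nat \<Rightarrow> nat \<Rightarrow> real" where
  "xi_coeff s k j = integral\<^sup>L lborel (\<lambda>x. hermite_fun j x * normalized_xi s k x)"

lemma borel_measurable_dilated_hermite_fun [measurable]:
  "dilated_hermite_fun s k \<in> borel_measurable borel"
  unfolding dilated_hermite_fun_def[abs_def] by measurable

lemma borel_measurable_normalized_xi [measurable]:
  "normalized_xi s k \<in> borel_measurable borel"
  unfolding normalized_xi_def[abs_def] by measurable

lemma has_bochner_integral_dilated_hermite_fun_mult:
  assumes s: "0 < s"
  shows "has_bochner_integral lborel (\<lambda>x. dilated_hermite_fun s j x * dilated_hermite_fun s k x) (if j = k then 1 else 0)"
proof -
  have "has_bochner_integral lborel (\<lambda>x. hermite_fun j x * hermite_fun k x) (if j = k then 1 else 0)"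
    using integrable_hermite_fun_mult integral_hermite_fun_mult by (simp add: has_bochner_integral_iff)
  then have "has_bochner_integral lborel (\<lambda>x. hermite_fun j (0 + (1 / s) * x) * hermite_fun k (0 + (1 / s) * x)) ((if j = k then 1 else 0) /\<^sub>R \<bar>1 / s\<bar>)"
    by (subst (asm) lborel_has_bochner_integral_real_affine_iff[of "1 / s" _ _ 0]) (use s in auto)
  from has_bochner_integral_divide_zero[OF this, of s] show ?thesis
    using s by (cases "j = k") (simp_all add: dilated_hermite_fun_def)
qed

text \<open>Half of the exponent belongs to e_k(x/s); the other half stays as a multiplier with
  values in (0, 1]. The constant undoes the normalisations of e_k and of the dilation.\<close>

lemma normalized_xi_eq:
  assumes s: "0 < s"
  shows "normalized_xi s k x = sqrt (sqrt pi * s) * (exp (- (x / s)\<^sup>2 / 2) * dilated_hermite_fun s k x)"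
proof -
  have "exp (- (x / s)\<^sup>2) = exp (- (x / s)\<^sup>2 / 2) * exp (- (x / s)\<^sup>2 / 2)"
    by (simp flip: exp_add)
  then show ?thesis
    using s by (simp add: normalized_xi_def dilated_hermite_fun_def hermite_fun_def real_sqrt_mult field_simps)
qed

lemma
  assumes s: "0 < s"
  shows integrable_normalized_xi_square: "integrable lborel (\<lambda>x. (normalized_xi s k x)\<^sup>2)"
    and integral_normalized_xi_square_le: "integral\<^sup>L lborel (\<lambda>x. (normalized_xi s k x)\<^sup>2) \<le> sqrt pi * s"
proof -
  have hb: "has_bochner_integral lborel (\<lambda>x. sqrt pi * s * (dilated_hermite_fun s k x * dilated_hermite_fun s k x)) (sqrt pi * s * 1)"
    using has_bochner_integral_mult_right[OF has_bochner_integral_dilated_hermite_fun_mult[OF s, of k k], of "sqrt pi * s"] by simp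
  have le: "(normalized_xi s k x)\<^sup>2 \<le> sqrt pi * s * (dilated_hermite_fun s k x * dilated_hermite_fun s k x)" for x
  proof -
    have "(normalized_xi s k x)\<^sup>2 = sqrt pi * s * ((exp (- (x / s)\<^sup>2 / 2))\<^sup>2 * (dilated_hermite_fun s k x)\<^sup>2)"
      using s by (simp add: normalized_xi_eq[OF s] power_mult_distrib)
    also have "\<dots> \<le> sqrt pi * s * (1 * (dilated_hermite_fun s k x)\<^sup>2)"
      using s by (intro mult_left_mono mult_right_mono power_le_one) auto
    finally show ?thesis by (simp add: power2_eq_square)
  qed
  show int: "integrable lborel (\<lambda>x. (normalized_xi s k x)\<^sup>2)"
    by (rule Bochner_Integration.integrable_bound[OF integrable.intros[OF hb]])
      (use le in \<open>auto intro: order.trans[OF _ abs_ge_self]\<close>)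
  have "integral\<^sup>L lborel (\<lambda>x. (normalized_xi s k x)\<^sup>2) \<le> integral\<^sup>L lborel (\<lambda>x. sqrt pi * s * (dilated_hermite_fun s k x * dilated_hermite_fun s k x))"
    using le by (intro integral_mono int integrable.intros[OF hb])
  then show "integral\<^sup>L lborel (\<lambda>x. (normalized_xi s k x)\<^sup>2) \<le> sqrt pi * s"
    unfolding has_bochner_integral_integral_eq[OF hb] by simp
qed

lemma integrable_hermite_fun_normalized_xi:
  "0 < s \<Longrightarrow> integrable lborel (\<lambda>x. hermite_fun j x * normalized_xi s k x)"
  by (intro integrable_mult_of_squares integrable_hermite_fun_square integrable_normalized_xi_square) auto

text \<open>Bessel's inequality in j for one fixed k. The bound is uniform in k but does not decay,
  so it can start the induction on p for the weighted sums, whereas summing over k without weights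
  requires the dual estimate that follows.\<close>

lemma sum_xi_coeff_square_le:
  assumes s: "0 < s" and "finite J"
  shows "(\<Sum>j\<in>J. (xi_coeff s k j)\<^sup>2) \<le> sqrt pi * s"
proof -
  have "(\<Sum>j\<in>J. (xi_coeff s k j)\<^sup>2) = (\<Sum>j\<in>J. (integral\<^sup>L lborel (\<lambda>x. normalized_xi s k x * hermite_fun j x))\<^sup>2)"
    by (simp add: xi_coeff_def mult.commute)
  also have "\<dots> \<le> integral\<^sup>L lborel (\<lambda>x. (normalized_xi s k x)\<^sup>2)"
    using assms integrable_hermite_fun_normalized_xi[OF s]
    by (intro bessel_inequality integrable_normalized_xi_square integrable_hermite_fun_mult integral_hermite_fun_mult)
       (auto simp: mult.commute)
  also have "\<dots> \<le> sqrt pi * s"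
    by (rule integral_normalized_xi_square_le[OF s])
  finally show ?thesis .
qed

text \<open>The dual estimate: here the Gaussian factor of \<open>normalized_xi\<close> is moved to the other side of
  the pairing, which leaves an orthonormal family in \<open>k\<close>.\<close>
lemma sum_pairing_xi_coeff_square_le:
  assumes s: "0 < s" and K: "finite K" and J: "finite J"
  shows "(\<Sum>k\<in>K. (\<Sum>j\<in>J. a j * xi_coeff s k j)\<^sup>2) \<le> sqrt pi * s * (\<Sum>j\<in>J. (a j)\<^sup>2)"
proof -
  define f where "f x = (\<Sum>j\<in>J. a j * hermite_fun j x)" for x
  define g where "g x = f x * exp (- (x / s)\<^sup>2 / 2)" for x
  have [measurable]: "f \<in> borel_measurable borel" "g \<in> borel_measurable borel"
    unfolding f_def[abs_def] g_def[abs_def] by measurable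
  have f2: "(f x)\<^sup>2 = (\<Sum>i\<in>J. \<Sum>j\<in>J. a i * a j * (hermite_fun i x * hermite_fun j x))" for x
    by (simp add: f_def power2_eq_square sum_product mult_ac)
  have intf: "integrable lborel (\<lambda>x. (f x)\<^sup>2)"
    unfolding f2 by (intro Bochner_Integration.integrable_sum integrable_mult_right integrable_hermite_fun_mult)
  have "integral\<^sup>L lborel (\<lambda>x. (f x)\<^sup>2) = (\<Sum>i\<in>J. \<Sum>j\<in>J. a i * a j * (if i = j then 1 else 0))"
    unfolding f2 by (simp add: integrable_hermite_fun_mult integral_hermite_fun_mult del: mult_eq_0_iff)
  also have "\<dots> = (\<Sum>j\<in>J. (a j)\<^sup>2)"
    using J by (simp add: if_distrib sum.delta power2_eq_square cong: if_cong)
  finally have normf: "integral\<^sup>L lborel (\<lambda>x. (f x)\<^sup>2) = (\<Sum>j\<in>J. (a j)\<^sup>2)" .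
  have gf: "(g x)\<^sup>2 \<le> (f x)\<^sup>2" for x
  proof -
    have "(exp (- (x / s)\<^sup>2 / 2))\<^sup>2 \<le> 1" by (intro power_le_one) auto
    then show ?thesis
      using mult_left_mono[of "(exp (- (x / s)\<^sup>2 / 2))\<^sup>2" 1 "(f x)\<^sup>2"] by (simp add: g_def power_mult_distrib)
  qed
  have intg: "integrable lborel (\<lambda>x. (g x)\<^sup>2)"
    by (rule Bochner_Integration.integrable_bound[OF intf]) (use gf in auto)
  have on: "integrable lborel (\<lambda>x. dilated_hermite_fun s i x * dilated_hermite_fun s j x)"
     "integral\<^sup>L lborel (\<lambda>x. dilated_hermite_fun s i x * dilated_hermite_fun s j x) = (if i = j then 1 else 0)" for i j
    using has_bochner_integral_dilated_hermite_fun_mult[OF s, of i j] by (auto simp: has_bochner_integral_iff)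
  have d2: "integrable lborel (\<lambda>x. (dilated_hermite_fun s k x)\<^sup>2)" for k
    using on(1)[of k k] by (simp add: power2_eq_square)
  have "(\<Sum>j\<in>J. a j * xi_coeff s k j) = sqrt (sqrt pi * s) * integral\<^sup>L lborel (\<lambda>x. g x * dilated_hermite_fun s k x)" for k
  proof -
    have "(\<Sum>j\<in>J. a j * xi_coeff s k j) = integral\<^sup>L lborel (\<lambda>x. \<Sum>j\<in>J. a j * (hermite_fun j x * normalized_xi s k x))"
      using integrable_hermite_fun_normalized_xi[OF s] by (simp add: xi_coeff_def)
    also have "\<dots> = integral\<^sup>L lborel (\<lambda>x. sqrt (sqrt pi * s) * (g x * dilated_hermite_fun s k x))"
      by (intro Bochner_Integration.integral_cong refl)
        (simp add: f_def g_def normalized_xi_eq[OF s] sum_distrib_left sum_distrib_right mult_ac)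
    finally show ?thesis by simp
  qed
  then have "(\<Sum>k\<in>K. (\<Sum>j\<in>J. a j * xi_coeff s k j)\<^sup>2) = sqrt pi * s * (\<Sum>k\<in>K. (integral\<^sup>L lborel (\<lambda>x. g x * dilated_hermite_fun s k x))\<^sup>2)"
    using s by (simp add: power_mult_distrib sum_distrib_left)
  also have "(\<Sum>k\<in>K. (integral\<^sup>L lborel (\<lambda>x. g x * dilated_hermite_fun s k x))\<^sup>2) \<le> integral\<^sup>L lborel (\<lambda>x. (g x)\<^sup>2)"
    by (intro bessel_inequality K intg on integrable_mult_of_squares d2) auto
  also have "\<dots> \<le> integral\<^sup>L lborel (\<lambda>x. (f x)\<^sup>2)"
    by (intro integral_mono intg intf gf)
  finally show ?thesis
    using s by (simp add: normf mult_left_mono)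
qed

section \<open>The three-term recurrence in the chaos order\<close>

lemma hermite_poly_Suc: "hermite_poly (Suc k) x = 2 * x * hermite_poly k x - 2 * real k * hermite_poly (k - 1) x"
  by (cases k) auto

text \<open>Apply y h_k = h_{k+1}/2 + k h_{k-1} twice. For k < 2 the factor k (k - 1) removes the
  term with the truncated index.\<close>

lemma square_mult_hermite_poly:
  "y\<^sup>2 * hermite_poly k y = hermite_poly (k + 2) y / 4 + (real k + 1/2) * hermite_poly k y
    + real k * (real k - 1) * hermite_poly (k - 2) y"
proof (cases k)
  case 0
  then show ?thesis by (simp add: power2_eq_square field_simps)
next
  case (Suc m)
  show ?thesis
    by (cases m) (auto simp: Suc power2_eq_square field_simps)
qed

text \<open>Differentiate h_{k+1} = 2x h_k - h_k' and replace the left side by 2(k+1) h_k.\<close>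

lemma hermite_ode:
  "poly (pderiv (pderiv (hermite k))) x = 2 * x * poly (pderiv (hermite k)) x - 2 * real k * poly (hermite k) x"
proof -
  have "hermite (Suc k) = [:0, 2:] * hermite k - pderiv (hermite k)"
    by (simp add: hermite_Suc pderiv_hermite)
  then have "pderiv (hermite (Suc k)) = pderiv ([:0, 2:] * hermite k - pderiv (hermite k))"
    by simp
  then have "poly (pderiv (hermite (Suc k))) x = poly (pderiv ([:0, 2:] * hermite k - pderiv (hermite k))) x"
    by simp
  then show ?thesis
    by (subst (asm) pderiv_hermite) (simp add: pderiv_mult pderiv_diff pderiv_pCons pderiv_smult algebra_simps)
qed

text \<open>\<open>xi_coeff\<close> without its normalising constants and with the two Gaussians
  merged into one, which is the form to which integration by parts for polynomials applies.\<close>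

definition xi_moment :: "real \<Rightarrow> nat \<Rightarrow> nat \<Rightarrow> real" where
  "xi_moment s k j = integral\<^sup>L lborel (\<lambda>x. hermite_poly j x * hermite_poly k (x / s) * exp (- (1/2 + 1 / s\<^sup>2) * x\<^sup>2))"

lemma xi_coeff_eq:
  "xi_coeff s k j = xi_moment s k j / (sqrt (sqrt pi * 2 ^ j * fact j) * sqrt (2 ^ k * fact k))"
proof -
  have "hermite_fun j x * normalized_xi s k x
    = hermite_poly j x * hermite_poly k (x / s) * exp (- (1/2 + 1 / s\<^sup>2) * x\<^sup>2)
       / (sqrt (sqrt pi * 2 ^ j * fact j) * sqrt (2 ^ k * fact k))" for x
  proof -
    have "exp (- (1/2 + 1 / s\<^sup>2) * x\<^sup>2) = exp (- (x\<^sup>2) / 2) * exp (- (x / s)\<^sup>2)"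
      by (simp add: algebra_simps power_divide flip: exp_add)
    then show ?thesis
      by (simp add: hermite_fun_def normalized_xi_def)
  qed
  then show ?thesis
    by (simp add: xi_coeff_def xi_moment_def)
qed

text \<open>Self-adjointness of \<open>-d\<^sup>2/dx\<^sup>2 + x\<^sup>2\<close> tested on the Hermite functions: the integrand that integrates to
  zero is the derivative of the Wronskian of the two functions.\<close>
lemma xi_moment_recurrence:
  assumes s: "0 < s"
  shows "(2 * real j + 1) * xi_moment s k j = (s\<^sup>2 / 4 - 1 / s\<^sup>2) * xi_moment s (k + 2) j
    + s\<^sup>2 * (real k + 1/2) * xi_moment s k j + s\<^sup>2 * real k * (real k - 1) * xi_moment s (k - 2) j"
proof -
  define \<sigma> where "\<sigma> = 1 / s\<^sup>2"
  define c where "c = 1/2 + \<sigma>"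
  have c: "0 < c" using s by (auto simp: c_def \<sigma>_def intro!: add_pos_pos)
  define p where "p = hermite j"
  define q where "q = pcompose (hermite k) [:0, 1 / s:]"
  \<comment> \<open>The polynomial factor of the Wronskian of p exp(-x^2/2) and q exp(-sigma x^2),
    sigma = 1/s^2; the last term comes from the different exponents.\<close>
  define P where "P = pderiv p * q - p * pderiv q - smult (1 - 2 * \<sigma>) ([:0, 1:] * p * q)"
  define m where "m i x = hermite_poly j x * hermite_poly i (x / s) * exp (- c * x\<^sup>2)" for i x
  have int: "integrable lborel (m i)" for i
    using integrable_poly_gaussian[OF c, of "hermite j * pcompose (hermite i) [:0, 1 / s:]"]
    by (simp add: m_def[abs_def] poly_hermite poly_pcompose)
  have xim: "xi_moment s i j = integral\<^sup>L lborel (m i)" for i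
    by (simp add: xi_moment_def m_def[abs_def] c_def \<sigma>_def)
  have pp: "poly (pderiv (pderiv p)) x = 2 * x * poly (pderiv p) x - 2 * real j * poly p x" for x
    unfolding p_def by (rule hermite_ode)
  \<comment> \<open>In the variable y = x/s: the second derivative of h_k(y) exp(-y^2) is h_{k+2}(y)
    exp(-y^2).\<close>
  have qq: "poly (pderiv (pderiv q)) x - 4 * \<sigma> * x * poly (pderiv q) x
      = \<sigma> * hermite_poly (k + 2) (x / s) - (4 * x\<^sup>2 * \<sigma>\<^sup>2 - 2 * \<sigma>) * poly q x" for x
  proof -
    have d: "poly (pderiv q) x = poly (pderiv (hermite k)) (x / s) / s" for x
      by (simp add: q_def pderiv_pcompose poly_pcompose pderiv_pCons)
    have d2: "poly (pderiv (pderiv q)) x = poly (pderiv (pderiv (hermite k))) (x / s) / s\<^sup>2" for x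
      by (simp add: q_def pderiv_pcompose poly_pcompose pderiv_pCons pderiv_mult pderiv_smult power2_eq_square)
    define y where "y = x / s"
    have x: "x = s * y" using s by (simp add: y_def)
    have h1: "poly (pderiv (hermite k)) y = 2 * y * hermite_poly k y - hermite_poly (Suc k) y"
      by (simp add: pderiv_hermite hermite_poly_Suc[of k] poly_hermite)
    have "poly (pderiv (pderiv q)) x - 4 * \<sigma> * x * poly (pderiv q) x
        = \<sigma> * (poly (pderiv (pderiv (hermite k))) y - 4 * y * poly (pderiv (hermite k)) y)"
      unfolding d d2 y_def[symmetric] using s by (simp add: x \<sigma>_def field_simps power2_eq_square)
    also have "\<dots> = \<sigma> * (hermite_poly (k + 2) y - (4 * y\<^sup>2 - 2) * hermite_poly k y)"
      unfolding hermite_ode h1 by (simp add: poly_hermite algebra_simps power2_eq_square)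
    also have "\<dots> = \<sigma> * hermite_poly (k + 2) y - (4 * x\<^sup>2 * \<sigma>\<^sup>2 - 2 * \<sigma>) * hermite_poly k y"
      using s by (simp add: x \<sigma>_def field_simps power2_eq_square)
    finally show ?thesis
      by (simp add: y_def q_def poly_pcompose poly_hermite)
  qed
  have pt: "poly (pderiv P - smult (2 * c) ([:0, 1:] * P)) x * exp (- c * x\<^sup>2)
     = (s\<^sup>2 / 4 - \<sigma>) * m (k + 2) x + s\<^sup>2 * (real k + 1/2) * m k x + s\<^sup>2 * real k * (real k - 1) * m (k - 2) x
       - (2 * real j + 1) * m k x" for x
  proof -
    define p0 where "p0 = poly p x"
    define p1 where "p1 = poly (pderiv p) x"
    define q0 where "q0 = poly q x"
    define q1 where "q1 = poly (pderiv q) x"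
    note d = p0_def p1_def q0_def q1_def
    have "poly (pderiv P - smult (2 * c) ([:0, 1:] * P)) x
      = q0 * (poly (pderiv (pderiv p)) x - 2 * x * p1) - p0 * (poly (pderiv (pderiv q)) x - 4 * \<sigma> * x * q1)
        - (1 - 2 * \<sigma>) * p0 * q0 + (1 - 4 * \<sigma>\<^sup>2) * x\<^sup>2 * p0 * q0"
      by (simp add: P_def c_def d pderiv_add pderiv_diff pderiv_mult pderiv_smult pderiv_pCons algebra_simps power2_eq_square)
    also have "\<dots> = p0 * (x\<^sup>2 * q0) - (2 * real j + 1) * p0 * q0 - \<sigma> * p0 * hermite_poly (k + 2) (x / s)"
      unfolding pp qq d by (simp add: algebra_simps power2_eq_square)
    also have "x\<^sup>2 * q0 = s\<^sup>2 * ((x / s)\<^sup>2 * hermite_poly k (x / s))"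
      using s by (simp add: d q_def poly_pcompose poly_hermite power_divide)
    also have "\<dots> = s\<^sup>2 * (hermite_poly (k + 2) (x / s) / 4 + (real k + 1/2) * hermite_poly k (x / s)
        + real k * (real k - 1) * hermite_poly (k - 2) (x / s))"
      by (simp only: square_mult_hermite_poly)
    finally have eq: "poly (pderiv P - smult (2 * c) ([:0, 1:] * P)) x
      = p0 * (s\<^sup>2 * (hermite_poly (k + 2) (x / s) / 4 + (real k + 1/2) * hermite_poly k (x / s)
          + real k * (real k - 1) * hermite_poly (k - 2) (x / s)))
        - (2 * real j + 1) * p0 * q0 - \<sigma> * p0 * hermite_poly (k + 2) (x / s)" .
    define hh where "hh i = hermite_poly i (x / s)" for i
    define e where "e = exp (- c * x\<^sup>2)"
    have m: "m i x = p0 * hh i * e" for i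
      by (simp add: m_def hh_def e_def p0_def p_def poly_hermite)
    have q0: "q0 = hh k"
      by (simp add: hh_def q0_def q_def poly_hermite poly_pcompose)
    show ?thesis
      unfolding eq m q0 hh_def[symmetric] e_def[symmetric] by (simp add: algebra_simps)
  qed
  have "0 = integral\<^sup>L lborel (\<lambda>x. (s\<^sup>2 / 4 - \<sigma>) * m (k + 2) x + s\<^sup>2 * (real k + 1/2) * m k x
      + s\<^sup>2 * real k * (real k - 1) * m (k - 2) x - (2 * real j + 1) * m k x)"
    using integral_deriv_poly_gaussian[OF c, of P] unfolding pt by simp
  also have "\<dots> = (s\<^sup>2 / 4 - \<sigma>) * xi_moment s (k + 2) j + s\<^sup>2 * (real k + 1/2) * xi_moment s k j
      + s\<^sup>2 * real k * (real k - 1) * xi_moment s (k - 2) j - (2 * real j + 1) * xi_moment s k j"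
    using int by (simp add: xim)
  finally show ?thesis by (simp add: \<sigma>_def)
qed

section \<open>Summation over the chaos orders\<close>

text \<open>For \<open>k < 2\<close> the index \<open>k - 2\<close> is truncated; its coefficient \<open>\<delta>\<close> then vanishes.\<close>
lemma xi_coeff_three_term_bound:
  assumes s: "0 < s"
  shows "(2 * real j + 2)\<^sup>2 * (xi_coeff s k j)\<^sup>2 \<le> 12 * (max (s\<^sup>2) (1 / s\<^sup>2))\<^sup>2 * (real k + 2)\<^sup>2
    * ((xi_coeff s (k + 2) j)\<^sup>2 + (xi_coeff s k j)\<^sup>2 + (xi_coeff s (k - 2) j)\<^sup>2)"
proof -
  define M where "M = max (s\<^sup>2) (1 / s\<^sup>2)"
  \<comment> \<open>A common bound for the three normalised coefficients. The 12 in the claim is the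
    3 from squaring a sum of three terms times the 4 in \<open>L\<^sup>2\<close>.\<close>
  define L where "L = 2 * M * (real k + 2)"
  define c where "c i = xi_coeff s i j" for i
  define Nj where "Nj = sqrt (sqrt pi * 2 ^ j * fact j)"
  define N where "N i = sqrt (2 ^ i * fact i :: real)" for i :: nat
  have N: "0 < N i" for i by (simp add: N_def)
  have Nj: "0 < Nj" by (simp add: Nj_def)
  have g: "xi_moment s i j = c i * Nj * N i" for i
    using N[of i] Nj by (simp add: c_def xi_coeff_eq N_def Nj_def)
  have NN: "N (i + 2) = sqrt (4 * (real i + 1) * (real i + 2)) * N i" for i
    by (simp add: N_def real_sqrt_mult[symmetric] algebra_simps)
  have s2: "0 < s\<^sup>2" "s\<^sup>2 \<le> M" "1 / s\<^sup>2 \<le> M" "1 \<le> M"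
    using s by (auto simp: M_def le_max_iff_disj)
  have L0: "0 \<le> L" using s2 by (simp add: L_def)
  define r where "r = sqrt (4 * (real k + 1) * (real k + 2))"
  have NNk: "N (k + 2) = r * N k"
    unfolding NN r_def ..
  define \<alpha> where "\<alpha> = (s\<^sup>2 / 4 - 1 / s\<^sup>2) * r"
  \<comment> \<open>The added 1 turns the eigenvalue 2j + 1 of -d^2/dx^2 + x^2 into the eigenvalue
    2j + 2 of A.\<close>
  define \<beta> where "\<beta> = s\<^sup>2 * (real k + 1/2) + 1"
  define \<delta> where "\<delta> = s\<^sup>2 * (real k * (real k - 1) * (N (k - 2) / N k))"
  have "(2 * real j + 1) * (c k * Nj * N k) = (s\<^sup>2 / 4 - 1 / s\<^sup>2) * (c (k + 2) * Nj * N (k + 2))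
      + s\<^sup>2 * (real k + 1/2) * (c k * Nj * N k) + s\<^sup>2 * real k * (real k - 1) * (c (k - 2) * Nj * N (k - 2))"
    using xi_moment_recurrence[OF s, of j k] unfolding g .
  also have "\<dots> = (\<alpha> * c (k + 2) + (\<beta> - 1) * c k + \<delta> * c (k - 2)) * (Nj * N k)"
    unfolding NNk using N[of k] by (simp add: \<alpha>_def \<beta>_def \<delta>_def field_simps)
  finally have "((2 * real j + 1) * c k) * (Nj * N k) = (\<alpha> * c (k + 2) + (\<beta> - 1) * c k + \<delta> * c (k - 2)) * (Nj * N k)"
    by (simp add: mult_ac)
  then have "(2 * real j + 1) * c k = \<alpha> * c (k + 2) + (\<beta> - 1) * c k + \<delta> * c (k - 2)"
    using N[of k] Nj by simp
  then have rec: "(2 * real j + 2) * c k = \<alpha> * c (k + 2) + \<beta> * c k + \<delta> * c (k - 2)"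
    by (simp add: algebra_simps)
  have \<alpha>: "\<bar>\<alpha>\<bar> \<le> L"
  proof -
    have "r \<le> 2 * (real k + 2)"
      unfolding r_def by (rule real_le_lsqrt) (auto simp: power2_eq_square algebra_simps)
    moreover have "0 \<le> r"
      by (simp add: r_def)
    moreover have "\<bar>s\<^sup>2 / 4 - 1 / s\<^sup>2\<bar> \<le> M"
    proof -
      have "0 < 1 / s\<^sup>2" using s2 by simp
      then show ?thesis using s2 by linarith
    qed
    ultimately have "\<bar>\<alpha>\<bar> \<le> M * (2 * (real k + 2))"
      unfolding \<alpha>_def abs_mult by (intro mult_mono) auto
    then show ?thesis by (simp add: L_def algebra_simps)
  qed
  have \<beta>: "\<bar>\<beta>\<bar> \<le> L"
  proof -
    have "\<beta> \<le> M * (real k + 1/2) + M"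
      unfolding \<beta>_def using s2 by (intro add_mono mult_right_mono) auto
    also have "\<dots> \<le> L"
      using s2 by (simp add: L_def algebra_simps)
    finally show ?thesis using s2 by (simp add: \<beta>_def)
  qed
  have \<delta>: "\<bar>\<delta>\<bar> \<le> L"
  proof (cases "k < 2")
    case True
    then have "real k * (real k - 1) = 0" by (cases k) auto
    then have "\<delta> = 0" unfolding \<delta>_def by (simp only: mult_zero_left div_0 mult_zero_right)
    then show ?thesis using L0 by simp
  next
    case False
    then obtain i where k: "k = i + 2"
      by (metis add.commute le_add_diff_inverse not_less)
    define r' where "r' = sqrt (4 * (real i + 1) * (real i + 2))"
    have r': "real i + 1 \<le> r'"
      unfolding r'_def by (rule real_le_rsqrt) (auto simp: power2_eq_square algebra_simps)
    have "N (i + 2) = r' * N i"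
      unfolding NN r'_def ..
    then have "N (k - 2) / N k = 1 / r'"
      unfolding k using N[of i] by simp
    then have "\<delta> = s\<^sup>2 * (real k * (real k - 1) * (1 / r'))"
      unfolding \<delta>_def by (simp only:)
    then have "\<delta> = s\<^sup>2 * ((real i + 2) * ((real i + 1) / r'))"
      by (simp add: k add.commute)
    moreover have "0 \<le> s\<^sup>2 * ((real i + 2) * ((real i + 1) / r'))"
      using r' by simp
    moreover have "s\<^sup>2 * ((real i + 2) * ((real i + 1) / r')) \<le> M * ((real i + 2) * 1)"
      using s2 r' by (intro mult_mono) auto
    moreover have "M * ((real i + 2) * 1) \<le> L"
      using s2 by (simp add: L_def k mult_left_mono mult_mono)
    ultimately show ?thesis by simp
  qed
  have sq3: "(x + y + z)\<^sup>2 \<le> 3 * (x\<^sup>2 + y\<^sup>2 + z\<^sup>2)" for x y z :: real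
  proof -
    have "0 \<le> (x - y)\<^sup>2 + (y - z)\<^sup>2 + (x - z)\<^sup>2" by simp
    then show ?thesis by (simp add: power2_eq_square algebra_simps)
  qed
  have sqL: "(x * y)\<^sup>2 \<le> L\<^sup>2 * y\<^sup>2" if "\<bar>x\<bar> \<le> L" for x y
  proof -
    have "x\<^sup>2 \<le> L\<^sup>2" using that by (simp add: abs_le_square_iff[symmetric] L0)
    then show ?thesis by (simp add: power_mult_distrib mult_right_mono)
  qed
  have "(2 * real j + 2)\<^sup>2 * (c k)\<^sup>2 = (\<alpha> * c (k + 2) + \<beta> * c k + \<delta> * c (k - 2))\<^sup>2"
    unfolding rec[symmetric] by (simp add: power_mult_distrib)
  also have "\<dots> \<le> 3 * ((\<alpha> * c (k + 2))\<^sup>2 + (\<beta> * c k)\<^sup>2 + (\<delta> * c (k - 2))\<^sup>2)"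
    by (rule sq3)
  also have "\<dots> \<le> 3 * (L\<^sup>2 * (c (k + 2))\<^sup>2 + L\<^sup>2 * (c k)\<^sup>2 + L\<^sup>2 * (c (k - 2))\<^sup>2)"
    by (intro mult_left_mono add_mono sqL \<alpha> \<beta> \<delta>) auto
  also have "\<dots> = 3 * L\<^sup>2 * ((c (k + 2))\<^sup>2 + (c k)\<^sup>2 + (c (k - 2))\<^sup>2)"
    by (simp add: algebra_simps)
  also have "3 * L\<^sup>2 = 12 * M\<^sup>2 * (real k + 2)\<^sup>2"
    by (simp add: L_def power_mult_distrib)
  finally show ?thesis by (simp add: c_def M_def)
qed

text \<open>Induction on p: the three-term bound trades one factor (2j + 2)^2 for the orders k+2, k
  and k-2, at the price of the square of the maximum and of k + 2. The constant must precede s, k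
  and J, because the induction hypothesis is used at three different orders.\<close>

lemma weighted_sum_xi_coeff_le:
  "\<exists>D\<ge>0. \<forall>s>0. \<forall>k J. finite J \<longrightarrow>
    (\<Sum>j\<in>J. (2 * real j + 2) ^ (2 * p) * (xi_coeff s k j)\<^sup>2)
      \<le> D * (real k + 1) ^ (2 * p) * (max (s\<^sup>2) (1 / s\<^sup>2)) ^ (2 * p) * (sqrt pi * s)"
proof (induction p)
  case 0
  show ?case
    using sum_xi_coeff_square_le by (intro exI[of _ 1]) auto
next
  case (Suc p)
  then obtain D where D: "0 \<le> D" and IH: "\<And>s k J. 0 < s \<Longrightarrow> finite J \<Longrightarrow>
      (\<Sum>j\<in>J. (2 * real j + 2) ^ (2 * p) * (xi_coeff s k j)\<^sup>2)
      \<le> D * (real k + 1) ^ (2 * p) * (max (s\<^sup>2) (1 / s\<^sup>2)) ^ (2 * p) * (sqrt pi * s)"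
    by blast
  \<comment> \<open>144 = 12 * 4 * 3: the constant of the three-term bound, k + 2 <= 2(k + 1)
    squared, and three sums. The factor 9^p comes from k + 3 <= 3(k + 1), where k + 3 is the base at
    the largest order k + 2.\<close>
  show ?case
  proof (intro exI[of _ "144 * 9 ^ p * D"] conjI allI impI)
    show "0 \<le> 144 * 9 ^ p * D" using D by simp
  next
    fix s :: real and k :: nat and J :: "nat set"
    assume s: "0 < s" and J: "finite J"
    define M where "M = max (s\<^sup>2) (1 / s\<^sup>2)"
    have M: "0 \<le> M" by (simp add: M_def le_max_iff_disj)
    define w where "w j = (2 * real j + 2) ^ (2 * p)" for j
    define B where "B = D * (real k + 3) ^ (2 * p) * M ^ (2 * p) * (sqrt pi * s)"
    have bd: "(\<Sum>j\<in>J. w j * (xi_coeff s i j)\<^sup>2) \<le> B" if "i \<le> k + 2" for i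
    proof -
      have "(\<Sum>j\<in>J. w j * (xi_coeff s i j)\<^sup>2) \<le> D * (real i + 1) ^ (2 * p) * M ^ (2 * p) * (sqrt pi * s)"
        unfolding w_def M_def by (rule IH[OF s J])
      also have "\<dots> \<le> B"
        unfolding B_def using that s D M by (intro mult_right_mono mult_left_mono power_mono) auto
      finally show ?thesis .
    qed
    have "(\<Sum>j\<in>J. (2 * real j + 2) ^ (2 * Suc p) * (xi_coeff s k j)\<^sup>2)
        = (\<Sum>j\<in>J. w j * ((2 * real j + 2)\<^sup>2 * (xi_coeff s k j)\<^sup>2))"
      by (simp add: w_def power2_eq_square mult_ac)
    also have "\<dots> \<le> (\<Sum>j\<in>J. w j * (12 * M\<^sup>2 * (real k + 2)\<^sup>2
        * ((xi_coeff s (k + 2) j)\<^sup>2 + (xi_coeff s k j)\<^sup>2 + (xi_coeff s (k - 2) j)\<^sup>2)))"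
      unfolding M_def by (intro sum_mono mult_left_mono xi_coeff_three_term_bound s) (auto simp: w_def)
    also have "\<dots> = 12 * M\<^sup>2 * (real k + 2)\<^sup>2 * ((\<Sum>j\<in>J. w j * (xi_coeff s (k + 2) j)\<^sup>2)
        + (\<Sum>j\<in>J. w j * (xi_coeff s k j)\<^sup>2) + (\<Sum>j\<in>J. w j * (xi_coeff s (k - 2) j)\<^sup>2))"
      unfolding sum.distrib[symmetric] sum_distrib_left by (intro sum.cong refl) (simp add: algebra_simps)
    also have "\<dots> \<le> 12 * M\<^sup>2 * (real k + 2)\<^sup>2 * (B + B + B)"
      by (intro mult_left_mono add_mono bd) auto
    also have "\<dots> \<le> 12 * M\<^sup>2 * (2 * (real k + 1))\<^sup>2 * (B + B + B)"
      using D s M by (intro mult_right_mono mult_left_mono power_mono) (auto simp: B_def)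
    also have "B \<le> D * (3 * (real k + 1)) ^ (2 * p) * M ^ (2 * p) * (sqrt pi * s)"
      unfolding B_def using D s M by (intro mult_right_mono mult_left_mono power_mono) auto
    also have "\<dots> = 9 ^ p * (D * (real k + 1) ^ (2 * p) * M ^ (2 * p) * (sqrt pi * s))" (is "_ = ?R")
    proof -
      have "(3 * (real k + 1)) ^ (2 * p) = 9 ^ p * (real k + 1) ^ (2 * p)"
        by (simp only: power_mult_distrib power_mult) simp
      then show ?thesis by simp
    qed
    also have "12 * M\<^sup>2 * (2 * (real k + 1))\<^sup>2 * (?R + ?R + ?R)
      = 144 * 9 ^ p * D * (real k + 1) ^ (2 * Suc p) * M ^ (2 * Suc p) * (sqrt pi * s)"
      by (simp add: power_mult_distrib algebra_simps power2_eq_square)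
    finally show "(\<Sum>j\<in>J. (2 * real j + 2) ^ (2 * Suc p) * (xi_coeff s k j)\<^sup>2)
      \<le> 144 * 9 ^ p * D * (real k + 1) ^ (2 * Suc p) * (max (s\<^sup>2) (1 / s\<^sup>2)) ^ (2 * Suc p) * (sqrt pi * s)"
      by (simp add: M_def mult_left_mono mult_right_mono)
  qed
qed

text \<open>The bound on v is asked for on finite sets because Bessel's inequality and the weighted
  estimate deliver it in that form.\<close>

lemma
  fixes u v :: "nat \<Rightarrow> real"
  assumes u: "summable (\<lambda>j. (u j)\<^sup>2)" and v: "\<And>J. finite J \<Longrightarrow> (\<Sum>j\<in>J. (v j)\<^sup>2) \<le> B"
  shows summable_mult_l2: "summable (\<lambda>j. u j * v j)"
    and suminf_Cauchy_Schwarz: "(\<Sum>j. u j * v j)\<^sup>2 \<le> (\<Sum>j. (u j)\<^sup>2) * B"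
proof -
  have sv: "summable (\<lambda>j. (v j)\<^sup>2)"
    by (rule summableI_nonneg_bounded[where x = B]) (auto intro: v)
  show sm: "summable (\<lambda>j. u j * v j)"
  proof (rule summable_comparison_test'[OF summable_add[OF u sv]])
    fix n
    have "2 * \<bar>u n * v n\<bar> \<le> (u n)\<^sup>2 + (v n)\<^sup>2"
      using sum_squares_bound[of "\<bar>u n\<bar>" "\<bar>v n\<bar>"] by (simp add: abs_mult)
    then show "norm (u n * v n) \<le> (u n)\<^sup>2 + (v n)\<^sup>2"
      by simp
  qed
  have B: "0 \<le> B" using v[of "{}"] by simp
  have "(\<lambda>n. (\<Sum>j<n. u j * v j)\<^sup>2) \<longlonglongrightarrow> (\<Sum>j. u j * v j)\<^sup>2"
    by (intro tendsto_intros summable_LIMSEQ sm)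
  then show "(\<Sum>j. u j * v j)\<^sup>2 \<le> (\<Sum>j. (u j)\<^sup>2) * B"
  proof (rule LIMSEQ_le_const2, intro exI allI impI)
    fix n
    have "(\<Sum>j<n. u j * v j)\<^sup>2 \<le> (\<Sum>j<n. (u j)\<^sup>2) * (\<Sum>j<n. (v j)\<^sup>2)"
      by (rule Cauchy_Schwarz_ineq_sum)
    also have "\<dots> \<le> (\<Sum>j. (u j)\<^sup>2) * B"
      by (intro mult_mono v sum_le_suminf u) (auto intro!: sum_nonneg suminf_nonneg u)
    finally show "(\<Sum>j<n. u j * v j)\<^sup>2 \<le> (\<Sum>j. (u j)\<^sup>2) * B" .
  qed
qed

text \<open>The divisor \<open>4 ^ (p * k)\<close> is what remains of the k-th power of the norm of
  M_H(1_[0,t]) after its power of t has cancelled against the other factors of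
  \<open>FB_term\<close>.\<close>

lemma weighted_sum_pairing_xi_bound:
  "\<exists>C\<ge>0. \<forall>s>0. \<forall>a. in_S_neg p a \<longrightarrow> (\<forall>k. summable (\<lambda>j. a j * xi_coeff s k j))
    \<and> summable (\<lambda>k. (\<Sum>j. a j * xi_coeff s k j)\<^sup>2 / 4 ^ (p * k))
    \<and> (\<Sum>k. (\<Sum>j. a j * xi_coeff s k j)\<^sup>2 / 4 ^ (p * k))
        \<le> C * (max (s\<^sup>2) (1 / s\<^sup>2)) ^ (2 * p) * s * S_neg_norm_sq p a"
proof (cases p)
  case 0
  have "(\<forall>k. summable (\<lambda>j. a j * xi_coeff s k j))
    \<and> summable (\<lambda>k. (\<Sum>j. a j * xi_coeff s k j)\<^sup>2)
    \<and> (\<Sum>k. (\<Sum>j. a j * xi_coeff s k j)\<^sup>2) \<le> sqrt pi * s * (\<Sum>j. (a j)\<^sup>2)"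
    if s: "0 < s" and a: "summable (\<lambda>j. (a j)\<^sup>2)" for s and a :: "nat \<Rightarrow> real"
  proof -
    define S where "S k = (\<Sum>j. a j * xi_coeff s k j)" for k
    have sm: "summable (\<lambda>j. a j * xi_coeff s k j)" for k
      by (rule summable_mult_l2[OF a sum_xi_coeff_square_le[OF s]])
    have le: "(\<Sum>k\<in>K. (S k)\<^sup>2) \<le> sqrt pi * s * (\<Sum>j. (a j)\<^sup>2)" if "finite K" for K
    proof -
      \<comment> \<open>The dual estimate covers only finite truncations of F. The set of chaos
        orders is kept finite while the truncation is removed.\<close>
      have "(\<lambda>n. \<Sum>k\<in>K. (\<Sum>j<n. a j * xi_coeff s k j)\<^sup>2) \<longlonglongrightarrow> (\<Sum>k\<in>K. (S k)\<^sup>2)"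
        unfolding S_def by (intro tendsto_intros summable_LIMSEQ sm)
      then show ?thesis
      proof (rule LIMSEQ_le_const2, intro exI allI impI)
        fix n
        have "(\<Sum>k\<in>K. (\<Sum>j<n. a j * xi_coeff s k j)\<^sup>2) \<le> sqrt pi * s * (\<Sum>j<n. (a j)\<^sup>2)"
          by (rule sum_pairing_xi_coeff_square_le[OF s that]) simp
        also have "\<dots> \<le> sqrt pi * s * (\<Sum>j. (a j)\<^sup>2)"
          using s by (intro mult_left_mono sum_le_suminf a) auto
        finally show "(\<Sum>k\<in>K. (\<Sum>j<n. a j * xi_coeff s k j)\<^sup>2) \<le> sqrt pi * s * (\<Sum>j. (a j)\<^sup>2)" .
      qed
    qed
    have sS: "summable (\<lambda>k. (S k)\<^sup>2)"
      by (rule summableI_nonneg_bounded) (auto intro: le)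
    with le have "(\<Sum>k. (S k)\<^sup>2) \<le> sqrt pi * s * (\<Sum>j. (a j)\<^sup>2)"
      by (intro suminf_le_const) auto
    with sm sS show ?thesis by (simp add: S_def)
  qed
  then show ?thesis
    unfolding 0 by (intro exI[of _ "sqrt pi"]) (auto simp: in_S_neg_def S_neg_norm_sq_def)
next
  case (Suc p')
  obtain D where D: "0 \<le> D" and D_bound: "\<And>s k J. 0 < s \<Longrightarrow> finite J \<Longrightarrow>
      (\<Sum>j\<in>J. (2 * real j + 2) ^ (2 * p) * (xi_coeff s k j)\<^sup>2)
      \<le> D * (real k + 1) ^ (2 * p) * (max (s\<^sup>2) (1 / s\<^sup>2)) ^ (2 * p) * (sqrt pi * s)"
    using weighted_sum_xi_coeff_le[of p] by blast
  have geo: "summable (\<lambda>k. (real k + 1) ^ (2 * p) / 4 ^ (p * k))"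
  proof (rule summable_comparison_test')
    show "summable (\<lambda>k. (real k + 1) ^ (2 * p) / 4 ^ k)"
    proof (rule summable_comparison_test_bigo)
      show "summable (\<lambda>k. norm ((1/2) ^ k :: real))"
        by (simp add: summable_geometric)
      show "(\<lambda>k. (real k + 1) ^ (2 * p) / 4 ^ k) \<in> O(\<lambda>k. (1/2) ^ k)"
      proof (rule landau_o.small_imp_big, rule smalloI_tendsto)
        have "(\<lambda>k. (real k + 1) ^ (2 * p) / 4 ^ k * 2 ^ k) \<longlonglongrightarrow> 0"
          by real_asymp
        then show "(\<lambda>k. (real k + 1) ^ (2 * p) / 4 ^ k / (1 / 2) ^ k) \<longlonglongrightarrow> 0"
          by (simp add: power_divide)
      qed auto
    qed
    fix k :: nat
    have "(4::real) ^ k \<le> 4 ^ (p * k)"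
      by (intro power_increasing) (auto simp: Suc)
    then show "norm ((real k + 1) ^ (2 * p) / 4 ^ (p * k)) \<le> (real k + 1) ^ (2 * p) / 4 ^ k"
      by (simp add: frac_le)
  qed
  define E where "E = (\<Sum>k. (real k + 1) ^ (2 * p) / 4 ^ (p * k))"
  have E: "0 \<le> E"
    unfolding E_def by (intro suminf_nonneg geo) auto
  show ?thesis
  proof (intro exI[of _ "D * sqrt pi * E"] conjI allI impI)
    show "0 \<le> D * sqrt pi * E" using D E by simp
  next
    fix s :: real and a :: "nat \<Rightarrow> real"
    assume s: "0 < s" and a: "in_S_neg p a"
    define M where "M = max (s\<^sup>2) (1 / s\<^sup>2)"
    \<comment> \<open>The weight (2j + 2)^p is shifted from F to the test function, so that
      Cauchy-Schwarz pairs the (-p)-norm of F with the p-norm of the test function.\<close>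
    define u where "u j = a j / (2 * real j + 2) ^ p" for j
    define v where "v k j = (2 * real j + 2) ^ p * xi_coeff s k j" for k j
    define S where "S k = (\<Sum>j. a j * xi_coeff s k j)" for k
    have uv: "a j * xi_coeff s k j = u j * v k j" for k j
      by (simp add: u_def v_def)
    have u2: "(u j)\<^sup>2 = (a j)\<^sup>2 / (2 * real j + 2) ^ (2 * p)" for j
      by (simp add: u_def power_divide power_mult[symmetric] mult.commute)
    have u: "summable (\<lambda>j. (u j)\<^sup>2)"
      using a by (simp add: u2 in_S_neg_def)
    have v: "(\<Sum>j\<in>J. (v k j)\<^sup>2) \<le> D * (real k + 1) ^ (2 * p) * M ^ (2 * p) * (sqrt pi * s)" if "finite J" for k J
      using D_bound[OF s that, of k] by (simp add: v_def M_def power_mult_distrib power_mult[symmetric] mult.commute[of p])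
    show "summable (\<lambda>j. a j * xi_coeff s k j)" for k
      unfolding uv by (rule summable_mult_l2[OF u v])
    define Q where "Q = D * sqrt pi * M ^ (2 * p) * s * S_neg_norm_sq p a"
    have S: "(S k)\<^sup>2 / 4 ^ (p * k) \<le> Q * ((real k + 1) ^ (2 * p) / 4 ^ (p * k))" for k
    proof -
      have "(S k)\<^sup>2 \<le> (\<Sum>j. (u j)\<^sup>2) * (D * (real k + 1) ^ (2 * p) * M ^ (2 * p) * (sqrt pi * s))"
        unfolding S_def uv by (rule suminf_Cauchy_Schwarz[OF u v])
      also have "\<dots> = Q * (real k + 1) ^ (2 * p)"
        by (simp add: u2 Q_def S_neg_norm_sq_def mult_ac)
      finally show ?thesis by (simp add: divide_right_mono)
    qed
    have sS: "summable (\<lambda>k. (S k)\<^sup>2 / 4 ^ (p * k))"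
      by (rule summable_comparison_test'[OF summable_mult[OF geo, of Q]]) (use S in auto)
    then show "summable (\<lambda>k. (\<Sum>j. a j * xi_coeff s k j)\<^sup>2 / 4 ^ (p * k))"
      by (simp add: S_def)
    have "(\<Sum>k. (S k)\<^sup>2 / 4 ^ (p * k)) \<le> (\<Sum>k. Q * ((real k + 1) ^ (2 * p) / 4 ^ (p * k)))"
      by (intro suminf_le S sS summable_mult geo)
    also have "\<dots> = Q * E"
      unfolding E_def by (rule suminf_mult[OF geo])
    finally show "(\<Sum>k. (\<Sum>j. a j * xi_coeff s k j)\<^sup>2 / 4 ^ (p * k))
        \<le> D * sqrt pi * E * (max (s\<^sup>2) (1 / s\<^sup>2)) ^ (2 * p) * s * S_neg_norm_sq p a"
      by (simp add: S_def Q_def M_def mult_ac)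
  qed
qed

section \<open>Assembly of the final bound\<close>

lemma xi_fun_eq:
  assumes t: "0 < t"
  shows "xi_fun t H k x = sqrt (fact k) * t powr (real k * H) * normalized_xi (sqrt 2 * t powr H) k x"
proof -
  have "sqrt (2 ^ k) = 2 powr (real k / 2)"
    by (simp add: powr_half_sqrt[symmetric] powr_realpow[symmetric] powr_powr)
  then have "2 powr (- real k / 2) = 1 / sqrt (2 ^ k)"
    by (simp add: powr_minus_divide)
  moreover have "(sqrt 2 * t powr H)\<^sup>2 = 2 * t powr (2 * H)"
    using t by (simp add: power_mult_distrib power2_eq_square[of "t powr H"] flip: powr_add)
  ultimately show ?thesis
    by (simp add: xi_fun_def normalized_xi_def power_divide real_sqrt_mult)
qed

text \<open>All k-dependent powers of t cancel: t^(-4kH) from the squared coefficient against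
  t^(2kH) from the squared pairing and t^(2kH) from the norm of M_H(1_[0,t]). The factorials cancel
  as well, since the squared pairing contributes one more k!.\<close>

lemma FB_term_le:
  assumes t: "0 < t" and H: "0 < H" "H < 1"
    and sm: "summable (\<lambda>j. a j * xi_coeff (sqrt 2 * t powr H) k j)"
  shows "0 \<le> FB_term p a H t k"
    and "FB_term p a H t k \<le> 1 / (2 * pi * t powr (2 * H)) * ((\<Sum>j. a j * xi_coeff (sqrt 2 * t powr H) k j)\<^sup>2 / 4 ^ (p * k))"
proof -
  define S where "S = (\<Sum>j. a j * xi_coeff (sqrt 2 * t powr H) k j)"
  define N where "N = MH_ind_norm_sq p H t"
  define \<tau> where "\<tau> = t powr H"
  have \<tau>: "0 < \<tau>" using t by (simp add: \<tau>_def)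
  have N: "0 \<le> N" "N \<le> \<tau>\<^sup>2 / 4 ^ p"
    using MH_ind_norm_sq_bounds[OF H t, of p] t by (auto simp: N_def \<tau>_def power2_eq_square simp flip: powr_add)
  have tp: "t powr (real k * H) = \<tau> ^ k"
    using t by (simp add: \<tau>_def powr_powr mult.commute flip: powr_realpow)
  have tm: "t powr (- 2 * real k * H) = 1 / \<tau> ^ (2 * k)"
    using t by (simp add: \<tau>_def powr_powr powr_minus_divide mult_ac flip: powr_realpow)
  have pr: "pairing a (xi_fun t H k) = sqrt (fact k) * \<tau> ^ k * S"
  proof -
    have "integral\<^sup>L lborel (\<lambda>x. hermite_fun j x * xi_fun t H k x)
        = sqrt (fact k) * \<tau> ^ k * xi_coeff (sqrt 2 * t powr H) k j" for j
      unfolding xi_coeff_def integral_mult_right_zero[symmetric] 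
      by (intro Bochner_Integration.integral_cong refl) (simp add: xi_fun_eq[OF t] tp)
    then have "pairing a (xi_fun t H k) = (\<Sum>j. sqrt (fact k) * \<tau> ^ k * (a j * xi_coeff (sqrt 2 * t powr H) k j))"
      by (simp add: pairing_def mult_ac)
    also have "\<dots> = sqrt (fact k) * \<tau> ^ k * S"
      unfolding S_def by (rule suminf_mult[OF sm])
    finally show ?thesis .
  qed
  show "0 \<le> FB_term p a H t k"
    using N by (simp add: FB_term_def N_def)
  have c: "(FB_coeff a H t k)\<^sup>2 = 1 / (2 * pi * \<tau>\<^sup>2) * (1 / fact k) * (1 / (\<tau>\<^sup>2) ^ k) * S\<^sup>2"
  proof -
    have "FB_coeff a H t k = 1 / (sqrt (2 * pi) * \<tau>) * (1 / fact k) * (1 / \<tau> ^ (2 * k)) * (sqrt (fact k) * \<tau> ^ k * S)"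
      unfolding FB_coeff_def pr tm \<tau>_def by simp
    also have "\<dots> = 1 / (sqrt (2 * pi) * \<tau>) * (sqrt (fact k) / fact k) * (1 / \<tau> ^ k) * S"
    proof -
      have cancel: "1 / (u * \<tau>) * (1 / f) * (1 / (x * x)) * (r * x * S) = 1 / (u * \<tau>) * (r / f) * (1 / x) * S"
        if "x \<noteq> 0" for u f x r :: real
        using that by simp
      show ?thesis
        unfolding mult_2 power_add by (rule cancel) (use \<tau> in simp)
    qed
    finally have "(FB_coeff a H t k)\<^sup>2 = 1 / (2 * pi * \<tau>\<^sup>2) * (fact k / (fact k)\<^sup>2) * (1 / (\<tau> ^ k)\<^sup>2) * S\<^sup>2"
      by (simp add: power_mult_distrib power_divide)
    then show ?thesis
      by (simp add: power2_eq_square[of "fact k"] power_mult[symmetric] mult.commute)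
  qed
  have "FB_term p a H t k = 1 / (2 * pi * \<tau>\<^sup>2) * (S\<^sup>2 * (1 / (\<tau>\<^sup>2) ^ k) * N ^ k)"
    unfolding FB_term_def c N_def by simp
  also have "\<dots> \<le> 1 / (2 * pi * \<tau>\<^sup>2) * (S\<^sup>2 * (1 / (\<tau>\<^sup>2) ^ k) * (\<tau>\<^sup>2 / 4 ^ p) ^ k)"
    by (intro mult_left_mono power_mono N) auto
  also have "S\<^sup>2 * (1 / (\<tau>\<^sup>2) ^ k) * (\<tau>\<^sup>2 / 4 ^ p) ^ k = S\<^sup>2 / 4 ^ (p * k)"
    using \<tau> by (simp add: power_divide power_mult)
  also have "\<tau>\<^sup>2 = t powr (2 * H)"
    using t by (simp add: \<tau>_def power2_eq_square flip: powr_add)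
  finally show "FB_term p a H t k \<le> 1 / (2 * pi * t powr (2 * H)) * ((\<Sum>j. a j * xi_coeff (sqrt 2 * t powr H) k j)\<^sup>2 / 4 ^ (p * k))"
    by (simp add: S_def)
qed

theorem mainTheorem11:
  fixes H1 H2 :: real and p :: nat
  assumes "0 < H1" and "H1 \<le> H2" and "H2 < 1"
  shows "\<exists>C::real. \<forall>(h::real \<Rightarrow> real) (a::nat \<Rightarrow> real) (t::real).
            continuous_on UNIV h \<and> (\<forall>x. H1 \<le> h x \<and> h x \<le> H2) \<and> in_S_neg p a \<and> 0 < t
            \<longrightarrow> summable (FB_term p a (h t) t)
              \<and> (\<Sum>k. FB_term p a (h t) t k)
                  \<le> max (t powr (- 4 * real p * h t)) (t powr (4 * real p * h t))
                     * t powr (- h t) * C * S_neg_norm_sq p a"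
proof -
  from weighted_sum_pairing_xi_bound[of p] obtain C where C: "0 \<le> C"
    and C_bound: "\<forall>s>0. \<forall>a. in_S_neg p a \<longrightarrow> (\<forall>k. summable (\<lambda>j. a j * xi_coeff s k j))
      \<and> summable (\<lambda>k. (\<Sum>j. a j * xi_coeff s k j)\<^sup>2 / 4 ^ (p * k))
      \<and> (\<Sum>k. (\<Sum>j. a j * xi_coeff s k j)\<^sup>2 / 4 ^ (p * k))
        \<le> C * (max (s\<^sup>2) (1 / s\<^sup>2)) ^ (2 * p) * s * S_neg_norm_sq p a"
    by (elim exE conjE) (rule that)
  show ?thesis
  \<comment> \<open>4^p is the factor 2 of s^2 = 2 t^(2H) to the power 2p, sqrt 2 comes from the
    single factor s, and 1/(2 pi) from the squared prefactor in \<open>FB_coeff\<close>.\<close>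
  proof (intro exI[of _ "C * 4 ^ p * sqrt 2 / (2 * pi)"] allI impI)
    fix h :: "real \<Rightarrow> real" and a :: "nat \<Rightarrow> real" and t :: real
    assume asm: "continuous_on UNIV h \<and> (\<forall>x. H1 \<le> h x \<and> h x \<le> H2) \<and> in_S_neg p a \<and> 0 < t"
    define H where "H = h t"
    define s where "s = sqrt 2 * t powr H"
    define T where "T k = (\<Sum>j. a j * xi_coeff s k j)\<^sup>2 / 4 ^ (p * k)" for k
    define A where "A = S_neg_norm_sq p a"
    have t: "0 < t" and a: "in_S_neg p a" using asm by auto
    have H: "0 < H" "H < 1"
      using asm assms unfolding H_def by (meson less_le_trans le_less_trans)+
    have s: "0 < s" using t by (simp add: s_def)
    note b = C_bound[THEN spec, THEN mp, OF s, THEN spec, THEN mp, OF a]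
    have smT: "summable T" and sumT: "(\<Sum>k. T k) \<le> C * (max (s\<^sup>2) (1 / s\<^sup>2)) ^ (2 * p) * s * A"
      using b unfolding T_def[abs_def] A_def by blast+
    have A: "0 \<le> A"
      using a unfolding A_def S_neg_norm_sq_def in_S_neg_def by (intro suminf_nonneg) auto
    define q where "q = 1 / (2 * pi * t powr (2 * H))"
    have FB: "0 \<le> FB_term p a H t k" "FB_term p a H t k \<le> q * T k" for k
      using FB_term_le[OF t H, of a k p] b unfolding q_def T_def s_def by blast+
    have smF: "summable (FB_term p a H t)"
      by (rule summable_comparison_test'[OF summable_mult[OF smT, of q]]) (use FB in auto)
    have s2: "s\<^sup>2 = 2 * t powr (2 * H)"
      using t by (simp add: s_def power_mult_distrib power2_eq_square[of "t powr H"] flip: powr_add)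
    define m where "m = max (t powr (- 4 * real p * H)) (t powr (4 * real p * H))"
    have pw: "(max (s\<^sup>2) (1 / s\<^sup>2)) ^ (2 * p) \<le> 4 ^ p * m"
    proof -
      have e1: "(t powr (2 * H)) ^ (2 * p) = t powr (4 * real p * H)"
        using t by (simp add: powr_powr mult_ac flip: powr_realpow)
      have e2: "(t powr (- 2 * H)) ^ (2 * p) = t powr (- 4 * real p * H)"
        using t by (simp add: powr_powr mult_ac flip: powr_realpow)
      have four: "(2::real) ^ (2 * p) = 4 ^ p"
        by (simp add: power_mult)
      have "(s\<^sup>2) ^ (2 * p) = 4 ^ p * t powr (4 * real p * H)"
        unfolding s2 power_mult_distrib e1 four ..
      also have "\<dots> \<le> 4 ^ p * m"
        by (simp add: m_def)
      finally have 1: "(s\<^sup>2) ^ (2 * p) \<le> 4 ^ p * m" .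
      \<comment> \<open>The exact factor is 1/2; it is weakened to 2 so that both branches of the
        maximum share the constant 4^p.\<close>
      have "1 / s\<^sup>2 \<le> 2 * t powr (- 2 * H)"
        using t unfolding s2 by (simp add: powr_minus_divide field_simps)
      then have "(1 / s\<^sup>2) ^ (2 * p) \<le> (2 * t powr (- 2 * H)) ^ (2 * p)"
        by (intro power_mono) auto
      also have "\<dots> = 4 ^ p * t powr (- 4 * real p * H)"
        unfolding power_mult_distrib e2 four ..
      also have "\<dots> \<le> 4 ^ p * m"
        by (simp add: m_def)
      finally have 2: "(1 / s\<^sup>2) ^ (2 * p) \<le> 4 ^ p * m" .
      from 1 2 show ?thesis by (simp add: max_def)
    qed
    have "(\<Sum>k. FB_term p a H t k) \<le> (\<Sum>k. q * T k)"
      by (intro suminf_le FB smF summable_mult smT)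
    also have "\<dots> = q * (\<Sum>k. T k)"
      by (rule suminf_mult[OF smT])
    also have "\<dots> \<le> q * (C * (4 ^ p * m) * s * A)"
    proof (rule mult_left_mono)
      have "C * (max (s\<^sup>2) (1 / s\<^sup>2)) ^ (2 * p) * s * A \<le> C * (4 ^ p * m) * s * A"
        using C s A pw by (intro mult_right_mono mult_left_mono) auto
      with sumT show "(\<Sum>k. T k) \<le> C * (4 ^ p * m) * s * A" by linarith
    qed (simp add: q_def)
    also have "\<dots> = m * (t powr H / t powr (2 * H)) * (C * 4 ^ p * sqrt 2 / (2 * pi)) * A"
      by (simp add: q_def s_def mult_ac)
    also have "t powr H / t powr (2 * H) = t powr (- H)"
      by (simp flip: powr_diff)
    finally have "(\<Sum>k. FB_term p a H t k) \<le> m * t powr (- H) * (C * 4 ^ p * sqrt 2 / (2 * pi)) * A" .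
    with smF show "summable (FB_term p a (h t) t) \<and> (\<Sum>k. FB_term p a (h t) t k)
        \<le> max (t powr (- 4 * real p * h t)) (t powr (4 * real p * h t))
          * t powr (- h t) * (C * 4 ^ p * sqrt 2 / (2 * pi)) * S_neg_norm_sq p a"
      unfolding H_def m_def A_def by blast
  qed
qed

end
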